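(* Let $K$ be a non-trivial (additively) idempotent semiring. Then $$\mu=\mu_K:\mathcal{TL}\to\mathcal M(K):a\mapsto\overline{\overline a}$$ is a faithful involutive category representation. In particular, for each $n\in\mathbb N$ the map $\mu$ gives a faithful involutive representation of the monoid $\mathcal{TL}_n$ by $f_n\times f_n$ matrices over $K$.
   Context: **Temperley–Lieb category.** $\mathbb N=\{0,1,2,\ldots\}$, $[n]=\{1,\ldots,n\}$. For $A\subseteq\mathbb N$, $A'$ and $A''$ are disjoint copies of $A$. $\mathcal{TL}_{m,n}$ is the set of all set partitions $a$ of $[m]\cup[n]'$ in which every block has size $2$ and which are planar: the graph with edges the blocks can be drawn without crossings with vertex $x\in[m]$ at $(x,1)$, $x'\in[n]'$ at $(x,0)$ and all edges inside the strip $0\le y\le1$. The elements of $a$ are called $a$-blocks. For $a\in\mathcal{TL}_{m,n}$, $b\in\mathcal{TL}_{n,t}$, the product graph $\Pi(a,b)$ has vertex set $[m]\cup[n]''\cup[t]'$ and edges those of $a$ (lower vertices $x'$ renamed $x''$) and of $b$ (upper vertices $x$ renamed $x''$); $ab\in\mathcal{TL}_{m,t}$ is the partition in which $x,y\in[m]\cup[t]'$ are in the same block iff they are in the same component of $\Pi(a,b)$. The category $\mathcal{TL}$ has objects $\mathbb N$, hom-sets $\mathcal{TL}_{m,n}$, this composition, identities $\iota_n=\{\{i,i'\}:i\in[n]\}$, and involution $a\mapsto a^*$ swapping $i\leftrightarrow i'$. $\mathcal{TL}_n=\mathcal{TL}_{n,n}$ is the endomorphism monoid at $n$. **Even-gap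 subsets.** $X\subseteq[n]$ is an even-gap subset of $[n]$ if $[n]\setminus X$ is a (possibly empty) disjoint union of intervals each containing an even number of points; equivalently, writing $X=\{x_1<\cdots<x_r\}$, $x_i\equiv i\bmod2$ for all $i$ and $r\equiv n\bmod2$. $\mathcal X_n$ is the set of even-gap subsets of $[n]$. The Fibonacci numbers are $f_0=f_1=1$, $f_n=f_{n-1}+f_{n-2}$ for $n\ge2$; one has $|\mathcal X_n|=f_n$. **Matrices.** A semiring $(K,+,\cdot,0,1)$ has $(K,+,0)$ a commutative monoid, $(K,\cdot,1)$ a monoid, distributivity, and $0$ a multiplicative zero; non-trivial means $0\ne1$; idempotent means $1+1=1$. $\mathcal M(K)$ is the category with object set $\mathbb N$, hom-sets the sets of $m\times n$ matrices over $K$, composition matrix multiplication, involution transpose. Matrices of size $f_m\times f_n$ are regarded as having rows and columns indexed by $\mathcal X_m$ and $\mathcal X_n$ (in some fixed order). For $a\in\mathcal{TL}_{m,n}$, $\overline{\overline a}$ is the $f_m\times f_n$ matrix over $K$ with, for $X\in\mathcal X_m$, $Y\in\mathcal X_n$, $\overline{\overline a}_{X,Y}=1$ if $X\cup Y'$ is a (possibly empty) union of $a$-blocks, and $0$ otherwise. **Representations.** A category representation is a functor; it is faithful if it is injective on objects and morphisms, and involutive if it preserves the involutions. A representation of a monoid is a monoid morphism; it is faithful if injective, and involutive if it preserves the involutions.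
   Formalization: As f_0=f_1=1, objects 0,1 and their identities have the same image in M(K), so full faithfulness is proved for matrices carrying their index sets X_m, X_n; in M(K) itself, μ is an involutive functor whose only coincidence is that of 0 with 1 and their identities. *)

theory Defs
  imports
    "HOL-Library.Disjoint_Sets"
    "HOL-Number_Theory.Fib"
    "HOL-Analysis.Path_Connected"
    "Jordan_Normal_Form.Matrix"
begin

section \<open>Categories with involution and their representations\<close>

text \<open>
  A functor is given on morphisms by a family of maps indexed by source and target, so
  that a value determines its source and target only if the value itself records them.
  The operation \<open>Star\<close> is not required to reverse composition: transposition of
  matrices over a noncommutative semiring does not.
\<close>

record ('o, 'm) icat =
  Obj :: "'o set"
  Hom :: "'o \<Rightarrow> 'o \<Rightarrow> 'm set"
  Comp :: "'o \<Rightarrow> 'o \<Rightarrow> 'o \<Rightarrow> 'm \<Rightarrow> 'm \<Rightarrow> 'm"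
  Ident :: "'o \<Rightarrow> 'm"
  Star :: "'m \<Rightarrow> 'm"

locale category =
  fixes C :: "('o, 'm) icat"
  assumes ident_in_hom: "x \<in> Obj C \<Longrightarrow> Ident C x \<in> Hom C x x"
    and comp_in_hom:
      "\<lbrakk>x \<in> Obj C; y \<in> Obj C; z \<in> Obj C; a \<in> Hom C x y; b \<in> Hom C y z\<rbrakk>
        \<Longrightarrow> Comp C x y z a b \<in> Hom C x z"
    and comp_assoc:
      "\<lbrakk>w \<in> Obj C; x \<in> Obj C; y \<in> Obj C; z \<in> Obj C;
        a \<in> Hom C w x; b \<in> Hom C x y; c \<in> Hom C y z\<rbrakk>
        \<Longrightarrow> Comp C w y z (Comp C w x y a b) c = Comp C w x z a (Comp C x y z b c)"
    and ident_left:
      "\<lbrakk>x \<in> Obj C; y \<in> Obj C; a \<in> Hom C x y\<rbrakk> \<Longrightarrow> Comp C x x y (Ident C x) a = a"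
    and ident_right:
      "\<lbrakk>x \<in> Obj C; y \<in> Obj C; a \<in> Hom C x y\<rbrakk> \<Longrightarrow> Comp C x y y a (Ident C y) = a"
    and star_in_hom:
      "\<lbrakk>x \<in> Obj C; y \<in> Obj C; a \<in> Hom C x y\<rbrakk> \<Longrightarrow> Star C a \<in> Hom C y x"
    and star_star:
      "\<lbrakk>x \<in> Obj C; y \<in> Obj C; a \<in> Hom C x y\<rbrakk> \<Longrightarrow> Star C (Star C a) = a"

locale cat_rep = C: category C + D: category D
  for C :: "('o, 'm) icat" and D :: "('p, 'n) icat" +
  fixes F0 :: "'o \<Rightarrow> 'p" and F :: "'o \<Rightarrow> 'o \<Rightarrow> 'm \<Rightarrow> 'n"
  assumes rep_obj: "x \<in> Obj C \<Longrightarrow> F0 x \<in> Obj D"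
    and rep_hom:
      "\<lbrakk>x \<in> Obj C; y \<in> Obj C; a \<in> Hom C x y\<rbrakk> \<Longrightarrow> F x y a \<in> Hom D (F0 x) (F0 y)"
    and rep_ident: "x \<in> Obj C \<Longrightarrow> F x x (Ident C x) = Ident D (F0 x)"
    and rep_comp:
      "\<lbrakk>x \<in> Obj C; y \<in> Obj C; z \<in> Obj C; a \<in> Hom C x y; b \<in> Hom C y z\<rbrakk>
        \<Longrightarrow> F x z (Comp C x y z a b) = Comp D (F0 x) (F0 y) (F0 z) (F x y a) (F y z b)"

locale involutive_cat_rep = cat_rep +
  assumes rep_star:
    "\<lbrakk>x \<in> Obj C; y \<in> Obj C; a \<in> Hom C x y\<rbrakk> \<Longrightarrow> F y x (Star C a) = Star D (F x y a)"

locale faithful_involutive_cat_rep = involutive_cat_rep +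
  assumes inj_on_objects: "inj_on F0 (Obj C)"
    and inj_on_morphisms:
      "inj_on (\<lambda>(x, y, a). F x y a) {(x, y, a). x \<in> Obj C \<and> y \<in> Obj C \<and> a \<in> Hom C x y}"

definition End :: "('o, 'm) icat \<Rightarrow> 'o \<Rightarrow> 'm monoid" where
  "End C x = \<lparr>carrier = Hom C x x, mult = Comp C x x x, one = Ident C x\<rparr>"

definition faithful_involutive_monoid_rep ::
  "'m monoid \<Rightarrow> ('m \<Rightarrow> 'm) \<Rightarrow> 'n monoid \<Rightarrow> ('n \<Rightarrow> 'n) \<Rightarrow> ('m \<Rightarrow> 'n) \<Rightarrow> bool" where
  "faithful_involutive_monoid_rep M s N t f \<longleftrightarrow>
     Group.monoid M \<and> Group.monoid N \<and>
     f \<in> hom M N \<and> f \<one>\<^bsub>M\<^esub> = \<one>\<^bsub>N\<^esub> \<and>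
     (\<forall>a\<in>carrier M. f (s a) = t (f a)) \<and>
     inj_on f (carrier M)"


section \<open>The Temperley--Lieb category\<close>

text \<open>\<open>Upper x\<close> stands for $x$ and \<open>Lower x\<close> for $x'$.\<close>

datatype vertex = Upper nat | Lower nat

definition vertices :: "nat \<Rightarrow> nat \<Rightarrow> vertex set" where
  "vertices m n = Upper ` {1..m} \<union> Lower ` {1..n}"

fun pos :: "vertex \<Rightarrow> real \<times> real" where
  "pos (Upper x) = (real x, 1)"
| "pos (Lower x) = (real x, 0)"

text \<open>
  In a partition into pairs every vertex is an endpoint of one of the arcs, so disjointness
  of the arcs also keeps an arc from passing through a vertex of another block.
\<close>

definition planar :: "vertex set set \<Rightarrow> bool" where
  "planar a \<longleftrightarrow>
     (\<exists>\<gamma> :: vertex set \<Rightarrow> real \<Rightarrow> real \<times> real.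
        (\<forall>B\<in>a. arc (\<gamma> B) \<and>
                {pathstart (\<gamma> B), pathfinish (\<gamma> B)} = pos ` B \<and>
                path_image (\<gamma> B) \<subseteq> {(x, y). 0 \<le> y \<and> y \<le> 1}) \<and>
        (\<forall>B\<in>a. \<forall>B'\<in>a. B \<noteq> B' \<longrightarrow> path_image (\<gamma> B) \<inter> path_image (\<gamma> B') = {}))"

definition TL_hom :: "nat \<Rightarrow> nat \<Rightarrow> vertex set set set" where
  "TL_hom m n = {a. partition_on (vertices m n) a \<and> (\<forall>B\<in>a. card B = 2) \<and> planar a}"

text \<open>Vertices of product graphs: \<open>PUpper x\<close>, \<open>PMiddle x\<close>, \<open>PLower x\<close> are $x$, $x''$, $x'$.\<close>

datatype pvertex = PUpper nat | PMiddle nat | PLower nat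

fun rename_first :: "vertex \<Rightarrow> pvertex" where
  "rename_first (Upper x) = PUpper x"
| "rename_first (Lower x) = PMiddle x"

fun rename_second :: "vertex \<Rightarrow> pvertex" where
  "rename_second (Upper x) = PMiddle x"
| "rename_second (Lower x) = PLower x"

fun outer :: "vertex \<Rightarrow> pvertex" where
  "outer (Upper x) = PUpper x"
| "outer (Lower x) = PLower x"

definition product_edges :: "vertex set set \<Rightarrow> vertex set set \<Rightarrow> pvertex set set" where
  "product_edges a b = (image rename_first) ` a \<union> (image rename_second) ` b"

definition connected_in_product ::
  "vertex set set \<Rightarrow> vertex set set \<Rightarrow> (pvertex \<times> pvertex) set" where
  "connected_in_product a b = {(u, v). {u, v} \<in> product_edges a b}\<^sup>*"

definition TL_comp ::
  "nat \<Rightarrow> nat \<Rightarrow> nat \<Rightarrow> vertex set set \<Rightarrow> vertex set set \<Rightarrow> vertex set set" where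
  "TL_comp m n t a b =
     vertices m t //
       {(x, y) \<in> vertices m t \<times> vertices m t. (outer x, outer y) \<in> connected_in_product a b}"

definition TL_ident :: "nat \<Rightarrow> vertex set set" where
  "TL_ident n = (\<lambda>i. {Upper i, Lower i}) ` {1..n}"

fun swap_vertex :: "vertex \<Rightarrow> vertex" where
  "swap_vertex (Upper x) = Lower x"
| "swap_vertex (Lower x) = Upper x"

definition TL_star :: "vertex set set \<Rightarrow> vertex set set" where
  "TL_star a = (image swap_vertex) ` a"

definition TL :: "(nat, vertex set set) icat" where
  "TL = \<lparr>Obj = UNIV, Hom = TL_hom, Comp = TL_comp, Ident = TL_ident, Star = TL_star\<rparr>"


section \<open>Matrix categories\<close>

definition mat_cat :: "(nat, 'k::semiring_1 mat) icat" where
  "mat_cat = \<lparr>Obj = UNIV, Hom = carrier_mat, Comp = (\<lambda>_ _ _ A B. A * B),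
              Ident = 1\<^sub>m, Star = transpose_mat\<rparr>"

text \<open>
  Matrices together with the index sets of their rows and columns. An index set is given
  with its order, as a list without repetitions; row \<open>i\<close> is the one indexed by the
  \<open>i\<close>-th entry of the list. The index sets matter only for injectivity: since
  $f_0 = f_1 = 1$, sizes alone do not separate the objects 0 and 1 nor their identities.
\<close>

definition indexed_mat_cat :: "('i list, 'i list \<times> 'i list \<times> 'k::semiring_1 mat) icat" where
  "indexed_mat_cat =
     \<lparr>Obj = {xs. distinct xs},
      Hom = (\<lambda>xs ys. {(xs, ys, A) | A. A \<in> carrier_mat (length xs) (length ys)}),
      Comp = (\<lambda>xs ys zs (_, _, A) (_, _, B). (xs, zs, A * B)),
      Ident = (\<lambda>xs. (xs, xs, 1\<^sub>m (length xs))),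
      Star = (\<lambda>(xs, ys, A). (ys, xs, transpose_mat A))\<rparr>"


section \<open>The matrices of Temperley--Lieb partitions\<close>

definition even_gap_subsets :: "nat \<Rightarrow> nat set set" where
  "even_gap_subsets n =
     {X. X \<subseteq> {1..n} \<and>
         (\<exists>P. partition_on ({1..n} - X) P \<and> (\<forall>I\<in>P. (\<exists>i j. I = {i..j}) \<and> even (card I)))}"

text \<open>
  The library's \<^term>\<open>fib\<close> starts with 0, 1, so that the number $f_n$ of even-gap subsets
  (with $f_0 = f_1 = 1$) is shifted by one.
\<close>

definition fibo :: "nat \<Rightarrow> nat" where
  "fibo n = fib (Suc n)"

definition union_of_blocks :: "vertex set set \<Rightarrow> nat set \<Rightarrow> nat set \<Rightarrow> bool" where
  "union_of_blocks a X Y \<longleftrightarrow> (\<exists>S\<subseteq>a. Upper ` X \<union> Lower ` Y = \<Union>S)"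

text \<open>The list \<open>es n\<close> is the chosen ordering of the even-gap subsets of $[n]$.\<close>

definition TL_mat ::
  "(nat \<Rightarrow> nat set list) \<Rightarrow> nat \<Rightarrow> nat \<Rightarrow> vertex set set \<Rightarrow> 'k::semiring_1 mat" where
  "TL_mat es m n a =
     mat (fibo m) (fibo n) (\<lambda>(i, j). if union_of_blocks a (es m ! i) (es n ! j) then 1 else 0)"

definition TL_indexed_mat ::
  "(nat \<Rightarrow> nat set list) \<Rightarrow> nat \<Rightarrow> nat \<Rightarrow> vertex set set \<Rightarrow>
     nat set list \<times> nat set list \<times> 'k::semiring_1 mat" where
  "TL_indexed_mat es m n a = (es m, es n, TL_mat es m n a)"

end

theory Submission
  imports Defs "HOL-Analysis.Fashoda_Theorem"
begin

text \<open>
  The proof replaces arcs in the strip by combinatorics on a line, then by parities.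

  \<^emph>\<open>Planarity.\<close> The map $(x,y)\mapsto e^{x+i\pi y}$ takes the strip onto the closed upper half plane without
  the origin and puts the vertices $x$ and $x'$ at $-e^x$ and $e^x$ on the real line. There, two
  arcs whose endpoints interlace must meet, by the theorem of Fashoda; conversely the semicircles
  over pairwise non-interlaced pairs are disjoint and can be pulled back to the strip. So planarity
  of a partition into pairs means that no two blocks interlace (\<open>TL_hom_iff\<close>).

  \<^emph>\<open>Products.\<close> A set $X\cup Y'$ is a union of $ab$-blocks iff for some $Z$ both $X\cup Z'$ is a
  union of $a$-blocks and $Z\cup Y'$ is a union of $b$-blocks: for $Z$ one can take the middle points
  connected to $X\cup Y'$ (\<open>union_of_blocks_comp\<close>). Over all subsets these relations determine a
  partition, which gives associativity and the identity laws of the category.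

  \<^emph>\<open>Parity.\<close> Let $W$ be a union of blocks and count for each point of $W$ the points outside $W$
  to its left in its row. The parity of this number is the same at both ends of a block in $W$
  (\<open>gap_parity_block\<close>): it is the colour of the region containing the block when the regions cut out
  by the blocks outside $W$ are coloured like a checkerboard. It is therefore constant on the components
  of a product graph. For even-gap subsets all these numbers are even, so if $X$ and $Y$ are
  even-gap, then so is the $Z$ above; hence the matrices, whose sums of ones collapse to 1 by
  idempotence, multiply correctly (\<open>TL_mat_comp\<close>). The same parity shows that a product of
  noncrossing partitions is noncrossing. That its blocks are pairs is seen by walking through the
  product graph along edges of $a$ and $b$ alternately.

  \<^emph>\<open>Faithfulness.\<close> Let a set of blocks contain all blocks that join the two rows, and with each block
  all blocks that enclose one of its points. What it leaves out are complete nests of arcs within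
  a row, so its union has even gaps (\<open>even_gap_upward_closed\<close>). Enough such sets exist to read
  off from the matrix which pairs in one row are blocks. The remaining points are joined from left to right
  in the only noncrossing way, so the partition is determined (\<open>eq_if_even_gap_unions_eq\<close>).
\<close>

section \<open>Noncrossing pairings of the boundary points\<close>

text \<open>
  The boundary of the strip, read from the right end of the upper row to its left end and then
  along the lower row from left to right, becomes a line: \<open>key\<close> is the coordinate on it. A block
  joins the two rows iff its keys lie on both sides of 0.
\<close>

fun key :: "vertex \<Rightarrow> int" where
  "key (Upper x) = - int x"
| "key (Lower x) = int x"

definition pairing :: "nat \<Rightarrow> nat \<Rightarrow> vertex set set \<Rightarrow> bool" where
  "pairing m n a \<longleftrightarrow> partition_on (vertices m n) a \<and> (\<forall>B\<in>a. card B = 2)"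

text \<open>
  The inequalities order the endpoints within each block, \<open>p\<close> before \<open>q\<close> and \<open>r\<close> before \<open>s\<close>; the case
  where the other block comes first is the same condition with the blocks exchanged.
\<close>

definition noncrossing :: "vertex set set \<Rightarrow> bool" where
  "noncrossing a \<longleftrightarrow>
     (\<nexists>p q r s. {p, q} \<in> a \<and> {r, s} \<in> a \<and> key p < key r \<and> key r < key q \<and> key q < key s)"

lemma noncrossingD:
  "noncrossing a \<Longrightarrow> {p, q} \<in> a \<Longrightarrow> {r, s} \<in> a \<Longrightarrow> key p < key r \<Longrightarrow> key r < key q \<Longrightarrow> \<not> key q < key s"
  unfolding noncrossing_def by blast

lemma Upper_in_vertices [simp]: "Upper x \<in> vertices m n \<longleftrightarrow> x \<in> {1..m}"
  and Lower_in_vertices [simp]: "Lower x \<in> vertices m n \<longleftrightarrow> x \<in> {1..n}"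
  by (auto simp: vertices_def)

lemma finite_vertices: "finite (vertices m n)"
  by (simp add: vertices_def)

lemma key_inj: "key v = key w \<Longrightarrow> v \<in> vertices m n \<Longrightarrow> w \<in> vertices m n \<Longrightarrow> v = w"
  by (cases v; cases w) auto

lemma key_nonzero: "v \<in> vertices m n \<Longrightarrow> key v \<noteq> 0"
  by (cases v) auto

lemma pairing_block:
  assumes "pairing m n a" "B \<in> a" "v \<in> B"
  obtains w where "B = {v, w}" "v \<noteq> w" "w \<in> vertices m n"
proof -
  have "card B = 2" using assms by (auto simp: pairing_def)
  then obtain w where "B = {v, w}" "v \<noteq> w"
    using assms(3) by (auto simp: card_2_iff)
  moreover have "B \<subseteq> vertices m n"
    using assms partition_onD1 by (fastforce simp: pairing_def)
  ultimately show thesis using that by auto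
qed

lemma pairing_partner:
  assumes "pairing m n a" "v \<in> vertices m n"
  obtains w where "{v, w} \<in> a" "v \<noteq> w" "w \<in> vertices m n"
proof -
  obtain B where "B \<in> a" "v \<in> B"
    using assms partition_onD1 by (fastforce simp: pairing_def)
  then show thesis using pairing_block[OF assms(1)] that by metis
qed

lemma pairing_neq: "pairing m n a \<Longrightarrow> {v, w} \<in> a \<Longrightarrow> v \<noteq> w"
  by (force simp: pairing_def)

lemma pairing_in_vertices: "pairing m n a \<Longrightarrow> B \<in> a \<Longrightarrow> v \<in> B \<Longrightarrow> v \<in> vertices m n"
  by (auto simp: pairing_def partition_on_def)

lemma pairing_block_unique:
  "pairing m n a \<Longrightarrow> B \<in> a \<Longrightarrow> C \<in> a \<Longrightarrow> v \<in> B \<Longrightarrow> v \<in> C \<Longrightarrow> B = C"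
  by (auto simp: pairing_def partition_on_def disjoint_def)

lemma pairing_partner_unique:
  "pairing m n a \<Longrightarrow> {v, w} \<in> a \<Longrightarrow> {v, u} \<in> a \<Longrightarrow> w = u"
  using pairing_block_unique[of m n a "{v, w}" "{v, u}" v] by (auto simp: doubleton_eq_iff)

section \<open>Planarity means that no two blocks interlace\<close>

text \<open>
  In complex notation this is \<open>exp (x + i \<pi> y)\<close>, and \<open>to_strip\<close> below is its inverse on the closed
  upper half plane. The arc cosine is used instead of the argument because it is continuous
  up to the negative real axis, where the upper row is.
\<close>

definition to_half_plane :: "real \<times> real \<Rightarrow> real \<times> real" where
  "to_half_plane p = (exp (fst p) * cos (pi * snd p), exp (fst p) * sin (pi * snd p))"

definition to_strip :: "real \<times> real \<Rightarrow> real \<times> real" where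
  "to_strip q = (ln (norm q), arccos (fst q / norm q) / pi)"

fun line_pos :: "vertex \<Rightarrow> real" where
  "line_pos (Upper x) = - exp (real x)"
| "line_pos (Lower x) = exp (real x)"

lemma line_pos_nonzero: "line_pos v \<noteq> 0"
  by (cases v) auto

lemma line_pos_mono: "key v < key w \<Longrightarrow> line_pos v < line_pos w"
proof (cases v; cases w)
  fix x y assume "key v < key w" "v = Upper x" "w = Lower y"
  moreover have "- exp (real x) < 0" "0 < exp (real y)" by simp_all
  ultimately show ?thesis by (simp del: exp_gt_zero) 
qed auto

lemma to_half_plane_pos: "to_half_plane (pos v) = (line_pos v, 0)"
  by (cases v) (auto simp: to_half_plane_def)

lemma ratio_norm: "- 1 \<le> fst q / norm q" "fst q / norm q \<le> 1" for q :: "real \<times> real"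
proof -
  have "\<bar>fst q\<bar> \<le> norm q"
    using real_sqrt_sum_squares_ge1[of "fst q" "snd q"]
    by (metis norm_fst_le norm_Pair prod.collapse real_norm_def)
  then have "\<bar>fst q / norm q\<bar> \<le> 1" by (simp add: divide_le_eq_1 abs_divide)
  then show "- 1 \<le> fst q / norm q" "fst q / norm q \<le> 1" by linarith+
qed

lemma to_half_plane_to_strip:
  assumes "q \<noteq> 0" "snd q \<ge> 0"
  shows "to_half_plane (to_strip q) = q"
proof -
  obtain x y where q: "q = (x, y)" by (cases q)
  define r where "r = norm q"
  have r: "r > 0" "r\<^sup>2 = x\<^sup>2 + y\<^sup>2" "y \<ge> 0"
    using assms by (auto simp: r_def q norm_Pair zero_prod_def sum_power2_gt_zero_iff)
  have c: "cos (arccos (x / r)) = x / r"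
    using ratio_norm[of q] by (auto simp: q r_def intro!: cos_arccos)
  have "sin (arccos (x / r)) = sqrt (1 - (x / r)\<^sup>2)"
    using ratio_norm[of q] by (auto simp: q r_def intro!: sin_arccos)
  also have "1 - (x / r)\<^sup>2 = (y / r)\<^sup>2"
  proof -
    have "y\<^sup>2 = r\<^sup>2 - x\<^sup>2" using r by simp
    then show ?thesis using r(1) by (simp add: power_divide diff_divide_distrib)
  qed
  also have "sqrt \<dots> = y / r" using r by simp
  finally have s: "sin (arccos (x / r)) = y / r" .
  show ?thesis
    using r c s by (simp add: to_half_plane_def to_strip_def q[symmetric] r_def[symmetric])
      (simp add: q r_def[symmetric])
qed

lemma to_half_plane_inj:
  assumes "to_half_plane p = to_half_plane q" "0 \<le> snd p" "snd p \<le> 1" "0 \<le> snd q" "snd q \<le> 1"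
  shows "p = q"
proof -
  have e: "exp (fst p) * cos (pi * snd p) = exp (fst q) * cos (pi * snd q)"
    "exp (fst p) * sin (pi * snd p) = exp (fst q) * sin (pi * snd q)"
    using assms(1) by (auto simp: to_half_plane_def)
  have *: "(exp x * cos y)\<^sup>2 + (exp x * sin y)\<^sup>2 = (exp x)\<^sup>2" for x y :: real
    by (simp add: power_mult_distrib flip: distrib_left)
  have "(exp (fst p))\<^sup>2 = (exp (fst q))\<^sup>2"
    using *[of "fst p" "pi * snd p"] *[of "fst q" "pi * snd q"] e by simp
  then have f: "fst p = fst q" by (simp add: power2_eq_iff_nonneg)
  have "cos (pi * snd p) = cos (pi * snd q)" using e f by simp
  then have "pi * snd p = pi * snd q"
    by (rule cos_inj_pi[rotated 4]) (use assms in \<open>auto simp: mult_left_le\<close>)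
  then show ?thesis using f by (simp add: prod_eq_iff)
qed

lemma to_strip_line_pos: "to_strip (line_pos v, 0) = pos v"
proof (cases v)
  case (Upper x)
  then show ?thesis by (simp add: to_strip_def norm_Pair)
next
  case (Lower x)
  then show ?thesis by (simp add: to_strip_def norm_Pair)
qed

lemma snd_to_strip: "0 \<le> snd (to_strip q)" "snd (to_strip q) \<le> 1"
  using arccos_bounded[OF ratio_norm[of q]]
  by (auto simp: to_strip_def divide_le_eq_1)

lemma continuous_on_to_strip: "continuous_on (- {0}) to_strip"
  unfolding to_strip_def
  by (intro continuous_intros ballI conjI ratio_norm) auto

lemma continuous_on_to_half_plane: "continuous_on S to_half_plane"
  unfolding to_half_plane_def by (intro continuous_intros)

lemma arc_oriented:
  fixes g :: "real \<Rightarrow> 'a::metric_space"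
  assumes "arc g" "{pathstart g, pathfinish g} = {x, y}"
  obtains h where "path h" "path_image h = path_image g" "pathstart h = x" "pathfinish h = y"
proof (cases "pathstart g = x \<and> pathfinish g = y")
  case True
  then show ?thesis using that arc_imp_path[OF assms(1)] by blast
next
  case False
  then have "pathstart g = y \<and> pathfinish g = x"
    using assms(2) by (auto simp: doubleton_eq_iff)
  then show ?thesis
    using that[of "reversepath g"] arc_imp_path[OF assms(1)] by simp
qed

text \<open>
  In the half plane all endpoints are on the bottom side of a large box that contains both arcs,
  and the interlacing form of Fashoda's theorem forces the arcs to meet.
\<close>

lemma planar_imp_noncrossing:
  assumes "planar a" shows "noncrossing a"
  unfolding noncrossing_def
proof (rule notI, elim exE conjE)
  fix p q r s
  assume B: "{p, q} \<in> a" "{r, s} \<in> a" and k: "key p < key r" "key r < key q" "key q < key s"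
  obtain \<gamma> where arcs: "\<forall>B\<in>a. arc (\<gamma> B) \<and>
        {pathstart (\<gamma> B), pathfinish (\<gamma> B)} = pos ` B \<and>
        path_image (\<gamma> B) \<subseteq> {(x, y). 0 \<le> y \<and> y \<le> 1}"
      and apart: "\<forall>B\<in>a. \<forall>B'\<in>a. B \<noteq> B' \<longrightarrow> path_image (\<gamma> B) \<inter> path_image (\<gamma> B') = {}"
    using assms unfolding planar_def by (elim exE conjE) (rule that)
  have \<gamma>: "arc (\<gamma> B)" "{pathstart (\<gamma> B), pathfinish (\<gamma> B)} = pos ` B"
      "path_image (\<gamma> B) \<subseteq> {(x, y). 0 \<le> y \<and> y \<le> 1}" if "B \<in> a" for B
    using arcs[rule_format, OF that] by auto
  have disj: "path_image (\<gamma> {p, q}) \<inter> path_image (\<gamma> {r, s}) = {}"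
    using apart[rule_format, OF B] k by (auto simp: doubleton_eq_iff)
  obtain f where f: "path f" "path_image f = path_image (\<gamma> {p, q})"
      "pathstart f = pos p" "pathfinish f = pos q"
    using arc_oriented[OF \<gamma>(1)[OF B(1)], of "pos p" "pos q"] \<gamma>(2)[OF B(1)] by auto
  obtain g where g: "path g" "path_image g = path_image (\<gamma> {r, s})"
      "pathstart g = pos r" "pathfinish g = pos s"
    using arc_oriented[OF \<gamma>(1)[OF B(2)], of "pos r" "pos s"] \<gamma>(2)[OF B(2)] by auto
  define \<phi> :: "real \<times> real \<Rightarrow> real^2" where
    "\<phi> z = (\<chi> i. if i = 1 then fst (to_half_plane z) else snd (to_half_plane z))" for z
  have \<phi>12: "\<phi> z $ 1 = fst (to_half_plane z)" "\<phi> z $ 2 = snd (to_half_plane z)" for z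
    by (simp_all add: \<phi>_def)
  have cont: "continuous_on S \<phi>" for S
    unfolding \<phi>_def
  proof (rule continuous_on_vec_lambda)
    fix i :: 2
    show "continuous_on S (\<lambda>x. if i = 1 then fst (to_half_plane x) else snd (to_half_plane x))"
      by (cases "i = 1") (auto intro!: continuous_intros continuous_on_to_half_plane)
  qed
  have strip: "0 \<le> snd z \<and> snd z \<le> 1" if "z \<in> path_image f \<union> path_image g" for z
    using that \<gamma>(3)[OF B(1)] \<gamma>(3)[OF B(2)] f g by auto
  have pf: "path (\<phi> \<circ> f)" "path (\<phi> \<circ> g)"
    using f g cont by (auto intro: path_continuous_image)
  have "compact (path_image (\<phi> \<circ> f) \<union> path_image (\<phi> \<circ> g))"
    using pf by (intro compact_Un compact_path_image)
  then obtain M where M: "\<And>x. x \<in> path_image (\<phi> \<circ> f) \<union> path_image (\<phi> \<circ> g) \<Longrightarrow> norm x \<le> M"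
    using compact_imp_bounded bounded_iff by metis
  define lo hi :: "real^2" where "lo = (\<chi> i. if i = 1 then - M else 0)" and "hi = (\<chi> i. M)"
  have box: "path_image (\<phi> \<circ> f) \<union> path_image (\<phi> \<circ> g) \<subseteq> cbox lo hi"
  proof
    fix x assume x: "x \<in> path_image (\<phi> \<circ> f) \<union> path_image (\<phi> \<circ> g)"
    then obtain z where z: "z \<in> path_image f \<union> path_image g" "x = \<phi> z"
      by (auto simp: path_image_compose)
    have "\<bar>x $ 1\<bar> \<le> M" "\<bar>x $ 2\<bar> \<le> M"
      using M[OF x] component_le_norm_cart[of x] order_trans by blast+
    moreover have "x $ 2 \<ge> 0"
      using strip[OF z(1)] z(2) by (auto simp: \<phi>12 to_half_plane_def
            intro!: mult_nonneg_nonneg sin_ge_zero mult_left_le)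
    ultimately show "x \<in> cbox lo hi"
      by (simp add: mem_box_cart forall_2 lo_def hi_def abs_le_iff)
  qed
  have ends: "pathstart (\<phi> \<circ> f) = \<phi> (pos p)" "pathfinish (\<phi> \<circ> f) = \<phi> (pos q)"
     "pathstart (\<phi> \<circ> g) = \<phi> (pos r)" "pathfinish (\<phi> \<circ> g) = \<phi> (pos s)"
    using f g by (simp_all add: pathstart_compose pathfinish_compose)
  obtain z where "z \<in> path_image (\<phi> \<circ> f)" "z \<in> path_image (\<phi> \<circ> g)"
  proof (rule fashoda_interlace[OF pf, of lo hi])
    show "path_image (\<phi> \<circ> f) \<subseteq> cbox lo hi" "path_image (\<phi> \<circ> g) \<subseteq> cbox lo hi"
      using box by auto
  qed (simp_all add: ends \<phi>12 to_half_plane_pos lo_def k line_pos_mono)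
  then obtain u v where uv: "u \<in> path_image f" "v \<in> path_image g" "\<phi> u = \<phi> v"
    by (auto simp: path_image_compose)
  then have "to_half_plane u = to_half_plane v"
    by (metis \<phi>12 prod_eq_iff)
  moreover have "0 \<le> snd u \<and> snd u \<le> 1" "0 \<le> snd v \<and> snd v \<le> 1"
    using strip uv(1,2) by blast+
  ultimately have "u = v"
    using to_half_plane_inj by blast
  then show False using uv disj f g by auto
qed

definition semicircle :: "real \<Rightarrow> real \<Rightarrow> real \<Rightarrow> real \<times> real" where
  "semicircle P Q t = ((P + Q) / 2 + (P - Q) / 2 * cos (pi * t), \<bar>P - Q\<bar> / 2 * sin (pi * t))"

lemma semicircle_equation:
  assumes "semicircle P Q t = (x, y)"
  shows "(x - P) * (Q - x) = y\<^sup>2"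
proof -
  have x: "x = (P + Q) / 2 + (P - Q) / 2 * cos (pi * t)" and y: "y = \<bar>P - Q\<bar> / 2 * sin (pi * t)"
    using assms by (auto simp: semicircle_def)
  have "y\<^sup>2 = ((P - Q) / 2)\<^sup>2 * (1 - (cos (pi * t))\<^sup>2)"
    unfolding y by (simp add: power_mult_distrib power_divide sin_squared_eq)
  also have "\<dots> = (x - P) * (Q - x)"
    unfolding x by (simp add: power2_eq_square field_simps)
  finally show ?thesis by simp
qed

lemma semicircle_nonzero:
  assumes "P \<noteq> 0" "Q \<noteq> 0" shows "semicircle P Q t \<noteq> 0"
proof
  assume "semicircle P Q t = 0"
  then have "semicircle P Q t = (0, 0)" by (simp add: zero_prod_def)
  from semicircle_equation[OF this] show False using assms by simp
qed

text \<open>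
  At a common point both products would equal the squared height, but for nested intervals both
  factors of the outer product are strictly larger.
\<close>

lemma circles_disjoint:
  fixes P Q P' Q' x y :: real
  assumes "P < Q" "P' < Q'" and eq: "(x - P) * (Q - x) = y\<^sup>2" "(x - P') * (Q' - x) = y\<^sup>2"
    and "Q < P' \<or> P < P' \<and> Q' < Q"
  shows False
proof -
  have between: "P \<le> x \<and> x \<le> Q" if "P < Q" "(x - P) * (Q - x) = y\<^sup>2" for P Q
  proof -
    have "0 \<le> (x - P) * (Q - x)" using that by simp
    then show ?thesis using that(1) by (auto simp: zero_le_mult_iff)
  qed
  have b: "P \<le> x" "x \<le> Q" "P' \<le> x" "x \<le> Q'" using between assms by auto
  show False
  proof (cases "Q < P'")
    case True then show ?thesis using b by simp
  next
    case False
    then have "P < P'" "Q' < Q" using assms by auto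
    then have "(x - P') * (Q' - x) < (x - P) * (Q - x)"
      using b by (intro mult_strict_mono') auto
    then show False using eq by simp
  qed
qed

text \<open>
  Semicircles on the real line over pairs that are separated or nested do not meet; they avoid the
  origin, so they can be carried back to the strip.
\<close>

lemma noncrossing_imp_planar:
  assumes pair: "pairing m n a" and nc: "noncrossing a"
  shows "planar a"
proof -
  have "\<exists>v w. B = {v, w} \<and> key v < key w" if "B \<in> a" for B
  proof -
    have "card B = 2" using that pair by (auto simp: pairing_def)
    then obtain v w where B: "B = {v, w}" "v \<noteq> w" by (auto simp: card_2_iff)
    then have "key v \<noteq> key w" 
      using key_inj pairing_in_vertices[OF pair that] by blast
    then have "key v < key w \<or> key w < key v" by linarith
    then show ?thesis using B by (metis insert_commute)
  qed
  then obtain l r where lr: "\<And>B. B \<in> a \<Longrightarrow> B = {l B, r B}" "\<And>B. B \<in> a \<Longrightarrow> key (l B) < key (r B)"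
    by metis
  define c where "c B = semicircle (line_pos (l B)) (line_pos (r B))" for B
  define \<gamma> where "\<gamma> B = to_strip \<circ> c B" for B
  have lt: "line_pos (l B) < line_pos (r B)" if "B \<in> a" for B
    using lr(2)[OF that] by (rule line_pos_mono)
  have c0: "c B t \<noteq> 0" for B t
    by (simp add: c_def semicircle_nonzero line_pos_nonzero)
  have cy: "snd (c B t) \<ge> 0" if "t \<in> {0..1}" for B t
    using that by (auto simp: c_def semicircle_def intro!: mult_nonneg_nonneg sin_ge_zero mult_left_le)
  have path: "path (\<gamma> B)" for B
    unfolding \<gamma>_def
  proof (rule path_continuous_image)
    show "path (c B)"
      unfolding c_def path_def semicircle_def by (intro continuous_intros)
    show "continuous_on (path_image (c B)) to_strip"
      by (rule continuous_on_subset[OF continuous_on_to_strip]) (use c0 in \<open>auto simp: path_image_def\<close>)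
  qed
  have c_eq: "c B s = c B' t" if "\<gamma> B s = \<gamma> B' t" "s \<in> {0..1}" "t \<in> {0..1}" for B B' s t
    using to_half_plane_to_strip[OF c0 cy] that unfolding \<gamma>_def o_def by metis
  have arc: "arc (\<gamma> B)" if B: "B \<in> a" for B
    unfolding arc_def
  proof (intro conjI path inj_onI)
    fix s t :: real assume st: "s \<in> {0..1}" "t \<in> {0..1}" "\<gamma> B s = \<gamma> B t"
    then have "c B s = c B t" using c_eq by blast
    then have "cos (pi * s) = cos (pi * t)"
      using lt[OF B] by (auto simp: c_def semicircle_def)
    then have "pi * s = pi * t"
      by (rule cos_inj_pi[rotated 4]) (use st in \<open>auto simp: mult_left_le\<close>)
    then show "s = t" by simp
  qed
  have ends: "{pathstart (\<gamma> B), pathfinish (\<gamma> B)} = pos ` B" if B: "B \<in> a" for B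
  proof -
    have "c B 0 = (line_pos (l B), 0)" "c B 1 = (line_pos (r B), 0)"
      by (auto simp: c_def semicircle_def field_simps)
    then have "pathstart (\<gamma> B) = pos (l B)" "pathfinish (\<gamma> B) = pos (r B)"
      by (simp_all add: \<gamma>_def pathstart_def pathfinish_def to_strip_line_pos)
    then show ?thesis using lr(1)[OF B] by (metis image_empty image_insert)
  qed
  have strip: "path_image (\<gamma> B) \<subseteq> {(x, y). 0 \<le> y \<and> y \<le> 1}" for B
  proof
    fix p assume "p \<in> path_image (\<gamma> B)"
    then obtain t where "p = to_strip (c B t)" by (auto simp: path_image_def \<gamma>_def)
    then show "p \<in> {(x, y). 0 \<le> y \<and> y \<le> 1}"
      using snd_to_strip[of "c B t"] by (simp add: split_beta)
  qed
  have disj: "path_image (\<gamma> B) \<inter> path_image (\<gamma> B') = {}" if B: "B \<in> a" "B' \<in> a" "B \<noteq> B'" for B B'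
  proof (rule ccontr)
    assume "\<not> ?thesis"
    then obtain p where "p \<in> \<gamma> B ` {0..1}" "p \<in> \<gamma> B' ` {0..1}"
      unfolding path_image_def by blast
    then obtain s t where st: "s \<in> {0..1}" "t \<in> {0..1}" "\<gamma> B s = \<gamma> B' t"
      by fastforce
    obtain x y where xy: "c B s = (x, y)" by fastforce
    then have xy': "c B' t = (x, y)" using c_eq[OF st(3,1,2)] by simp
    note e = semicircle_equation[OF xy[unfolded c_def]] semicircle_equation[OF xy'[unfolded c_def]]
    have ne: "key u \<noteq> key v" if "u \<in> B" "v \<in> B'" for u v
      using that B key_inj pairing_in_vertices[OF pair] pairing_block_unique[OF pair] by metis
    have in_B: "l B \<in> B" "r B \<in> B" "l B' \<in> B'" "r B' \<in> B'" using lr(1) B by blast+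
    have nx: "\<not> (key (l B) < key (l B') \<and> key (l B') < key (r B) \<and> key (r B) < key (r B'))"
      "\<not> (key (l B') < key (l B) \<and> key (l B) < key (r B') \<and> key (r B') < key (r B))"
      using nc lr(1) B unfolding noncrossing_def by metis+
    have "key (r B) < key (l B') \<or> key (r B') < key (l B) \<or>
        key (l B) < key (l B') \<and> key (r B') < key (r B) \<or>
        key (l B') < key (l B) \<and> key (r B) < key (r B')"
      using nx ne[OF in_B(1,3)] ne[OF in_B(1,4)] ne[OF in_B(2,3)] ne[OF in_B(2,4)] by linarith
    then show False
      using circles_disjoint[OF lt[OF B(1)] lt[OF B(2)] e]
        circles_disjoint[OF lt[OF B(2)] lt[OF B(1)] e(2,1)] line_pos_mono by blast
  qed
  show ?thesis
    unfolding planar_def using arc ends strip disj by blast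
qed

lemma TL_hom_iff: "a \<in> TL_hom m n \<longleftrightarrow> pairing m n a \<and> noncrossing a"
  using planar_imp_noncrossing noncrossing_imp_planar
  by (auto simp: TL_hom_def pairing_def)

section \<open>Unions of blocks\<close>

definition rows :: "nat set \<Rightarrow> nat set \<Rightarrow> vertex set" where
  "rows X Y = Upper ` X \<union> Lower ` Y"

lemma Upper_in_rows [simp]: "Upper x \<in> rows X Y \<longleftrightarrow> x \<in> X"
  and Lower_in_rows [simp]: "Lower y \<in> rows X Y \<longleftrightarrow> y \<in> Y"
  by (auto simp: rows_def)

lemma union_of_blocks_rows: "union_of_blocks a X Y \<longleftrightarrow> (\<exists>S\<subseteq>a. rows X Y = \<Union>S)"
  by (simp add: union_of_blocks_def rows_def)

lemma rows_subset_vertices: "rows X Y \<subseteq> vertices m n \<longleftrightarrow> X \<subseteq> {1..m} \<and> Y \<subseteq> {1..n}"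
  by (auto simp: vertices_def rows_def)

lemma rows_in_vertices: "v \<in> rows X Y \<Longrightarrow> X \<subseteq> {1..m} \<Longrightarrow> Y \<subseteq> {1..n} \<Longrightarrow> v \<in> vertices m n"
  by (cases v) auto

lemma card_rows: "finite X \<Longrightarrow> finite Y \<Longrightarrow> card (rows X Y) = card X + card Y"
  unfolding rows_def by (subst card_Un_disjoint) (auto simp: card_image inj_on_def)

lemma rows_diff: "vertices m n - rows X Y = rows ({1..m} - X) ({1..n} - Y)"
  by (auto simp: vertices_def rows_def)

lemma rows_split: "B = rows {x. Upper x \<in> B} {y. Lower y \<in> B}"
proof (rule Set.set_eqI)
  fix v show "v \<in> B \<longleftrightarrow> v \<in> rows {x. Upper x \<in> B} {y. Lower y \<in> B}"
    by (cases v) auto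
qed

lemma noncrossing_inside:
  assumes pair: "pairing m n a" and nc: "noncrossing a"
    and B: "B \<in> a" "u \<in> B" "u' \<in> B" "{v, w} \<in> a" "B \<noteq> {v, w}" and k: "key v < key u" "key u < key w"
  shows "key v < key u' \<and> key u' < key w"
proof (cases "u' = u")
  case False
  then have Bu: "B = {u, u'}"
    using pairing_block[OF pair B(1,2)] B(3) by blast
  have u': "u' \<noteq> v" "u' \<noteq> w"
    using pairing_block_unique[OF pair B(1,4,3)] B(5) by auto
  have "u' \<in> vertices m n" "v \<in> vertices m n" "w \<in> vertices m n"
    using pairing_in_vertices[OF pair B(1,3)] pairing_in_vertices[OF pair B(4)] by auto
  then have "key u' \<noteq> key v" "key u' \<noteq> key w"
    using key_inj u' by metis+
  moreover have "\<not> key u' < key v"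
    using noncrossingD[OF nc, of u' u v w] B(1,4) k by (auto simp: Bu insert_commute)
  moreover have "\<not> key w < key u'"
    using noncrossingD[OF nc, of v w u u'] B(1,4) k by (auto simp: Bu)
  ultimately show ?thesis by linarith
qed (use k in simp)

text \<open>
  Used for every parity argument below: a set closed under passing to the other end of a block is a
  union of blocks, which are disjoint pairs.
\<close>

lemma even_card_closed:
  assumes pair: "pairing m n a" and U: "U \<subseteq> vertices m n"
    and closed: "\<And>v w. {v, w} \<in> a \<Longrightarrow> v \<in> U \<Longrightarrow> w \<in> U"
  shows "even (card U)"
proof -
  define S where "S = {B \<in> a. B \<subseteq> U}"
  have S: "\<Union>S = U"
  proof
    show "U \<subseteq> \<Union>S"
    proof
      fix v assume v: "v \<in> U"
      then obtain w where w: "{v, w} \<in> a" using pairing_partner[OF pair] U by blast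
      then have "{v, w} \<in> S" using closed v by (auto simp: S_def)
      then show "v \<in> \<Union>S" by blast
    qed
  qed (auto simp: S_def)
  have "card (\<Union>S) = sum card S"
  proof (rule card_Union_disjoint)
    show "pairwise disjnt S"
      using pair by (auto simp: S_def pairwise_def disjnt_def pairing_def partition_on_def disjoint_def)
    show "\<And>A. A \<in> S \<Longrightarrow> finite A"
      using pair by (auto simp: S_def pairing_def intro: card_ge_0_finite)
  qed
  also have "\<dots> = sum (\<lambda>_. 2) S"
    using pair by (intro sum.cong) (auto simp: S_def pairing_def)
  finally show ?thesis by (simp add: S)
qed

lemma union_of_blocks_iff:
  assumes "partition_on (vertices m n) a"
  shows "union_of_blocks a X Y \<longleftrightarrow>
    X \<subseteq> {1..m} \<and> Y \<subseteq> {1..n} \<and> (\<forall>B\<in>a. \<forall>v\<in>B. \<forall>w\<in>B. v \<in> rows X Y \<longrightarrow> w \<in> rows X Y)"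
proof
  assume "union_of_blocks a X Y"
  then obtain S where S: "S \<subseteq> a" "rows X Y = \<Union>S" by (auto simp: union_of_blocks_rows)
  then have "rows X Y \<subseteq> vertices m n"
    using partition_onD1[OF assms] by auto
  moreover have "w \<in> rows X Y" if B: "B \<in> a" "v \<in> B" "w \<in> B" "v \<in> rows X Y" for B v w
  proof -
    obtain C where C: "C \<in> S" "v \<in> C" using B(4) unfolding S(2) by blast
    then have "B = C" using B(1,2) S(1) partition_onD2[OF assms] by (auto simp: disjoint_def)
    then show ?thesis unfolding S(2) using C B(3) by blast
  qed
  ultimately show "X \<subseteq> {1..m} \<and> Y \<subseteq> {1..n} \<and>
      (\<forall>B\<in>a. \<forall>v\<in>B. \<forall>w\<in>B. v \<in> rows X Y \<longrightarrow> w \<in> rows X Y)"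
    unfolding rows_subset_vertices by blast
next
  assume R: "X \<subseteq> {1..m} \<and> Y \<subseteq> {1..n} \<and>
      (\<forall>B\<in>a. \<forall>v\<in>B. \<forall>w\<in>B. v \<in> rows X Y \<longrightarrow> w \<in> rows X Y)"
  have "rows X Y = \<Union>{B\<in>a. B \<subseteq> rows X Y}"
  proof
    show "rows X Y \<subseteq> \<Union>{B\<in>a. B \<subseteq> rows X Y}"
    proof
      fix v assume v: "v \<in> rows X Y"
      then have "v \<in> vertices m n" using R by (elim conjE) (rule rows_in_vertices)
      then obtain B where "B \<in> a" "v \<in> B" using partition_onD1[OF assms] by auto
      moreover from this have "B \<subseteq> rows X Y"
        using R v by (intro subsetI) (elim conjE, metis)
      ultimately show "v \<in> \<Union>{B\<in>a. B \<subseteq> rows X Y}" by blast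
    qed
  qed blast
  then show "union_of_blocks a X Y"
    unfolding union_of_blocks_rows by (intro exI[of _ "{B\<in>a. B \<subseteq> rows X Y}"]) auto
qed

lemma pairing_partition: "pairing m n a \<Longrightarrow> partition_on (vertices m n) a"
  by (simp add: pairing_def)

lemma union_of_blocks_pairing_iff:
  assumes "pairing m n a"
  shows "union_of_blocks a X Y \<longleftrightarrow>
    X \<subseteq> {1..m} \<and> Y \<subseteq> {1..n} \<and> (\<forall>v w. {v, w} \<in> a \<longrightarrow> v \<in> rows X Y \<longrightarrow> w \<in> rows X Y)"
proof -
  have "(\<forall>B\<in>a. \<forall>v\<in>B. \<forall>w\<in>B. v \<in> rows X Y \<longrightarrow> w \<in> rows X Y) \<longleftrightarrow>
        (\<forall>v w. {v, w} \<in> a \<longrightarrow> v \<in> rows X Y \<longrightarrow> w \<in> rows X Y)" (is "?L \<longleftrightarrow> ?R")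
  proof
    assume R: ?R
    show ?L
    proof (intro ballI impI)
      fix B v w assume B: "B \<in> a" "v \<in> B" "w \<in> B" "v \<in> rows X Y"
      obtain u where "B = {v, u}" using pairing_block[OF assms B(1,2)] by blast
      then show "w \<in> rows X Y" using R B by (metis insertE singletonD)
    qed
  next
    assume L: ?L
    show ?R
    proof (intro allI impI)
      fix v w assume "{v, w} \<in> a" "v \<in> rows X Y"
      then show "w \<in> rows X Y" using L[rule_format, of "{v, w}" v w] by simp
    qed
  qed
  then show ?thesis unfolding union_of_blocks_iff[OF pairing_partition[OF assms]] by simp
qed

lemma union_of_blocksD:
  assumes "pairing m n a" "union_of_blocks a X Y"
  shows "X \<subseteq> {1..m}" "Y \<subseteq> {1..n}"
    and "{v, w} \<in> a \<Longrightarrow> v \<in> rows X Y \<Longrightarrow> w \<in> rows X Y"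
  using assms(2) unfolding union_of_blocks_pairing_iff[OF assms(1)] by blast+

section \<open>Parity of gaps along a block\<close>

fun gap :: "nat set \<Rightarrow> nat set \<Rightarrow> vertex \<Rightarrow> nat" where
  "gap X Y (Upper x) = card ({1..<x} - X)"
| "gap X Y (Lower y) = card ({1..<y} - Y)"

lemma separated_xor:
  fixes v w z :: int
  assumes "z \<noteq> 0" "z \<noteq> v" "z \<noteq> w"
  shows "((0 < z \<and> z < v \<or> v < z \<and> z < 0) \<noteq> (0 < z \<and> z < w \<or> w < z \<and> z < 0)) \<longleftrightarrow>
    v < z \<and> z < w \<or> w < z \<and> z < v"
  using assms by arith

lemma even_card_sym_diff:
  assumes "finite A" "finite B"
  shows "even (card A + card B) \<longleftrightarrow> even (card ((A - B) \<union> (B - A)))"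
proof -
  have "card A = card (A - B) + card (A \<inter> B)" "card B = card (B - A) + card (A \<inter> B)"
    using assms card_Int_Diff[of A B] card_Int_Diff[of B A] by (simp_all add: Int_commute)
  moreover have "card ((A - B) \<union> (B - A)) = card (A - B) + card (B - A)"
    using assms by (intro card_Un_disjoint) auto
  ultimately show ?thesis by auto
qed

text \<open>
  In the line coordinate, the points to the left of \<open>v\<close> in its row are those between 0 and \<open>key v\<close>.
  This treats both rows alike.
\<close>

lemma gap_eq_card:
  assumes "v \<in> vertices m n"
  shows "gap X Y v = card {u \<in> vertices m n - rows X Y.
    0 < key u \<and> key u < key v \<or> key v < key u \<and> key u < 0}" (is "_ = card ?A")
proof (cases v)
  case (Upper x)
  have "?A = Upper ` ({1..<x} - X)"
  proof (intro Set.set_eqI)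
    fix u show "u \<in> ?A \<longleftrightarrow> u \<in> Upper ` ({1..<x} - X)"
      using assms by (cases u) (auto simp: Upper)
  qed
  then show ?thesis by (simp add: Upper card_image inj_on_def)
next
  case (Lower x)
  have "?A = Lower ` ({1..<x} - Y)"
  proof (intro Set.set_eqI)
    fix u show "u \<in> ?A \<longleftrightarrow> u \<in> Lower ` ({1..<x} - Y)"
      using assms by (cases u) (auto simp: Lower)
  qed
  then show ?thesis by (simp add: Lower card_image inj_on_def)
qed

text \<open>
  The points between 0 and \<open>v\<close> and the points between 0 and \<open>w\<close> differ exactly by the points between
  \<open>v\<close> and \<open>w\<close>, whichever rows the two vertices are in.
\<close>

lemma gap_parity_between:
  assumes "X \<subseteq> {1..m}" "Y \<subseteq> {1..n}" "v \<in> rows X Y" "w \<in> rows X Y"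
  shows "even (gap X Y v) = even (gap X Y w) \<longleftrightarrow>
    even (card {u \<in> vertices m n - rows X Y.
      key v < key u \<and> key u < key w \<or> key w < key u \<and> key u < key v})"
proof -
  let ?A = "\<lambda>v. {u \<in> vertices m n - rows X Y.
    0 < key u \<and> key u < key v \<or> key v < key u \<and> key u < 0}"
  have vw: "v \<in> vertices m n" "w \<in> vertices m n"
    using assms rows_subset_vertices by blast+
  have "(?A v - ?A w) \<union> (?A w - ?A v) = {u \<in> vertices m n - rows X Y.
      key v < key u \<and> key u < key w \<or> key w < key u \<and> key u < key v}"
  proof (intro Set.set_eqI)
    fix u
    show "u \<in> (?A v - ?A w) \<union> (?A w - ?A v) \<longleftrightarrow> u \<in> {u \<in> vertices m n - rows X Y.
      key v < key u \<and> key u < key w \<or> key w < key u \<and> key u < key v}"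
    proof (cases "u \<in> vertices m n - rows X Y")
      case True
      then have "key u \<noteq> 0" "key u \<noteq> key v" "key u \<noteq> key w"
        using key_nonzero key_inj vw assms by blast+
      from separated_xor[OF this] show ?thesis using True by blast
    qed auto
  qed
  moreover have "finite (?A v)" "finite (?A w)" using finite_vertices by auto
  ultimately show ?thesis
    using even_card_sym_diff[of "?A v" "?A w"] gap_eq_card[OF vw(1)] gap_eq_card[OF vw(2)]
    by (metis (no_types, lifting) even_add)
qed

text \<open>
  No block has just one end under the block \<open>{v, w}\<close>, so the missing points under it form whole blocks.
\<close>

lemma gap_parity_block:
  assumes pair: "pairing m n a" and nc: "noncrossing a" and un: "union_of_blocks a X Y"
    and vw: "{v, w} \<in> a" "v \<in> rows X Y"
  shows "even (gap X Y v) = even (gap X Y w)"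
proof -
  note XY = union_of_blocksD(1,2)[OF pair un] and cl = union_of_blocksD(3)[OF pair un]
  have w: "w \<in> rows X Y" using cl vw by blast
  let ?I = "{u \<in> vertices m n - rows X Y.
      key v < key u \<and> key u < key w \<or> key w < key u \<and> key u < key v}"
  have "even (card ?I)"
  proof (rule even_card_closed[OF pair])
    fix u u' assume u: "{u, u'} \<in> a" "u \<in> ?I"
    have "u' \<notin> rows X Y" using cl[of u' u] u by (auto simp: insert_commute)
    moreover have "u' \<in> vertices m n" using pairing_in_vertices[OF pair u(1)] by blast
    moreover have ne: "{u, u'} \<noteq> {v, w}" "{u, u'} \<noteq> {w, v}"
      using u(2) vw w by (auto simp: doubleton_eq_iff)
    have "{w, v} \<in> a" using vw by (simp add: insert_commute)
    then have "key v < key u' \<and> key u' < key w \<or> key w < key u' \<and> key u' < key v"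
      using noncrossing_inside[OF pair nc u(1) _ _ vw(1) ne(1), of u u']
         noncrossing_inside[OF pair nc u(1) _ _ _ ne(2), of u u'] u(2) by blast
    ultimately show "u' \<in> ?I" by blast
  qed blast
  then show ?thesis using gap_parity_between[OF XY vw(2) w] by blast
qed


section \<open>Connectedness in product graphs\<close>

lemma inj_rename: "inj rename_first" "inj rename_second" "inj outer"
proof -
  show "inj rename_first"
  proof (rule injI)
    fix v w show "rename_first v = rename_first w \<Longrightarrow> v = w" by (cases v; cases w) auto
  qed
  show "inj rename_second"
  proof (rule injI)
    fix v w show "rename_second v = rename_second w \<Longrightarrow> v = w" by (cases v; cases w) auto
  qed
  show "inj outer"
  proof (rule injI)
    fix v w show "outer v = outer w \<Longrightarrow> v = w" by (cases v; cases w) auto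
  qed
qed

text \<open>
  The edges of one layer of a product graph, as a relation; \<open>f\<close> places the layer in the product.
\<close>

definition edge :: "vertex set set \<Rightarrow> (vertex \<Rightarrow> pvertex) \<Rightarrow> (pvertex \<times> pvertex) set" where
  "edge a f = {(f v, f w) | v w. {v, w} \<in> a}"

lemma image_pair_iff:
  assumes "inj f" shows "{p, q} \<in> image f ` a \<longleftrightarrow> (p, q) \<in> edge a f"
proof
  assume "{p, q} \<in> image f ` a"
  then obtain B where B: "B \<in> a" "f ` B = {p, q}" by auto
  then obtain v w where "p = f v" "q = f w" by (metis imageE insertCI)
  moreover from this have "B = {v, w}"
    using B(2) inj_image_eq_iff[OF assms, of B "{v, w}"] by simp
  ultimately show "(p, q) \<in> edge a f" using B by (auto simp: edge_def)
next
  assume "(p, q) \<in> edge a f"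
  then obtain v w where "p = f v" "q = f w" "{v, w} \<in> a" by (auto simp: edge_def)
  then have "{p, q} = f ` {v, w}" by simp
  then show "{p, q} \<in> image f ` a" using \<open>{v, w} \<in> a\<close> by blast
qed

lemma connected_eq: "connected_in_product a b = (edge a rename_first \<union> edge b rename_second)\<^sup>*"
  unfolding connected_in_product_def product_edges_def
  by (rule arg_cong[where f = rtrancl]) (auto simp: image_pair_iff inj_rename)

lemma sym_edge: "sym (edge a f)"
  by (auto simp: sym_def edge_def) (metis insert_commute)

lemma sym_connected: "sym (connected_in_product a b)"
  unfolding connected_eq by (intro sym_rtrancl sym_Un sym_edge)

lemma trans_connected: "trans (connected_in_product a b)"
  unfolding connected_eq by (rule trans_rtrancl)

lemma connected_step:
  assumes "(p, q) \<in> connected_in_product a b"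
  shows "{v, w} \<in> a \<Longrightarrow> q = rename_first v \<Longrightarrow> (p, rename_first w) \<in> connected_in_product a b"
    and "{v, w} \<in> b \<Longrightarrow> q = rename_second v \<Longrightarrow> (p, rename_second w) \<in> connected_in_product a b"
  using assms rtrancl_into_rtrancl[of p q "edge a rename_first \<union> edge b rename_second"]
  unfolding connected_eq edge_def by blast+

lemma connected_invariant [consumes 1, case_names base first second]:
  assumes "(p, q) \<in> connected_in_product a b" "P p"
    and "\<And>v w. {v, w} \<in> a \<Longrightarrow> P (rename_first v) \<Longrightarrow> P (rename_first w)"
    and "\<And>v w. {v, w} \<in> b \<Longrightarrow> P (rename_second v) \<Longrightarrow> P (rename_second w)"
  shows "P q"
  using assms(1,2) unfolding connected_eq
  by (induction rule: rtrancl_induct) (auto simp: edge_def assms(3,4))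

fun in_rows :: "nat set \<Rightarrow> nat set \<Rightarrow> nat set \<Rightarrow> pvertex \<Rightarrow> bool" where
  "in_rows X Z Y (PUpper x) \<longleftrightarrow> x \<in> X"
| "in_rows X Z Y (PMiddle x) \<longleftrightarrow> x \<in> Z"
| "in_rows X Z Y (PLower x) \<longleftrightarrow> x \<in> Y"

lemma in_rows_simps:
  "in_rows X Z Y (rename_first v) \<longleftrightarrow> v \<in> rows X Z"
  "in_rows X Z Y (rename_second v) \<longleftrightarrow> v \<in> rows Z Y"
  "in_rows X Z Y (outer v) \<longleftrightarrow> v \<in> rows X Y"
  by (cases v; auto)+

lemma vertices_rows: "vertices m n = rows {1..m} {1..n}"
  by (simp add: vertices_def rows_def)

lemma connected_in_range:
  assumes "pairing m n a" "pairing n t b" "v \<in> vertices m t" "(outer v, q) \<in> connected_in_product a b"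
  shows "in_rows {1..m} {1..n} {1..t} q"
  using assms(4)
proof (induction rule: connected_invariant)
  case base
  show ?case
    using assms(3) by (simp add: in_rows_simps vertices_rows)
next
  case (first v w)
  then have "w \<in> vertices m n"
    using pairing_in_vertices[OF assms(1)] by blast
  then show ?case by (simp only: in_rows_simps vertices_rows)
next
  case (second v w)
  then have "w \<in> vertices n t"
    using pairing_in_vertices[OF assms(2)] by blast
  then show ?case by (simp only: in_rows_simps vertices_rows)
qed

definition comp_equiv ::
  "nat \<Rightarrow> nat \<Rightarrow> vertex set set \<Rightarrow> vertex set set \<Rightarrow> (vertex \<times> vertex) set" where
  "comp_equiv m t a b =
     {(x, y) \<in> vertices m t \<times> vertices m t. (outer x, outer y) \<in> connected_in_product a b}"

lemma equiv_comp_equiv: "equiv (vertices m t) (comp_equiv m t a b)"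
proof (rule equivI)
  show "refl_on (vertices m t) (comp_equiv m t a b)"
    by (auto simp: refl_on_def comp_equiv_def connected_eq)
  show "sym (comp_equiv m t a b)"
    using sym_connected by (fastforce simp: sym_def comp_equiv_def)
  show "trans (comp_equiv m t a b)"
    using trans_connected by (fastforce simp: trans_def comp_equiv_def)
qed (auto simp: comp_equiv_def)

lemma TL_comp_eq: "TL_comp m n t a b = vertices m t // comp_equiv m t a b"
  by (simp add: TL_comp_def comp_equiv_def)

lemma partition_TL_comp: "partition_on (vertices m t) (TL_comp m n t a b)"
  unfolding TL_comp_eq by (intro partition_on_quotient equiv_comp_equiv)

lemma TL_comp_block:
  assumes "B \<in> TL_comp m n t a b" "v \<in> B"
  shows "w \<in> B \<longleftrightarrow> w \<in> vertices m t \<and> (outer v, outer w) \<in> connected_in_product a b"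
proof -
  have "(v, w) \<in> comp_equiv m t a b" if "w \<in> B"
    using quotient_eq_iff[OF equiv_comp_equiv, of B m t a b B v w] that assms
    unfolding TL_comp_eq by simp
  moreover have "w \<in> B" if "(v, w) \<in> comp_equiv m t a b"
    using in_quotient_imp_closed[OF equiv_comp_equiv, of B m t a b v w] that assms
    unfolding TL_comp_eq by simp
  moreover have "v \<in> vertices m t"
    using assms partition_onD1[OF partition_TL_comp[of m t n a b]] by auto
  moreover have "(v, w) \<in> comp_equiv m t a b \<longleftrightarrow> v \<in> vertices m t \<and> w \<in> vertices m t \<and>
      (outer v, outer w) \<in> connected_in_product a b"
    by (simp add: comp_equiv_def)
  ultimately show ?thesis by blast
qed

lemma union_of_blocks_comp_iff:
  "union_of_blocks (TL_comp m n t a b) X Y \<longleftrightarrow> X \<subseteq> {1..m} \<and> Y \<subseteq> {1..t} \<and>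
     (\<forall>v\<in>rows X Y. \<forall>w\<in>vertices m t. (outer v, outer w) \<in> connected_in_product a b \<longrightarrow> w \<in> rows X Y)"
  (is "?L \<longleftrightarrow> ?R")
proof
  assume L: ?L
  note L0 = L[unfolded union_of_blocks_iff[OF partition_TL_comp]]
  note L' = L0[THEN conjunct1] L0[THEN conjunct2, THEN conjunct1] L0[THEN conjunct2, THEN conjunct2]
  have "w \<in> rows X Y" if v: "v \<in> rows X Y" "w \<in> vertices m t"
      "(outer v, outer w) \<in> connected_in_product a b" for v w
  proof -
    have "v \<in> vertices m t" using rows_in_vertices[OF v(1) L'(1,2)] .
    then obtain B where B: "B \<in> TL_comp m n t a b" "v \<in> B"
      using partition_onD1[OF partition_TL_comp[of m t n a b]] by auto
    then have "w \<in> B" using TL_comp_block[OF B] v by simp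
    then show ?thesis using L'(3)[rule_format, OF B, of w] v(1) by simp
  qed
  then show ?R using L'(1,2) by simp
next
  assume R: ?R
  show ?L
    unfolding union_of_blocks_iff[OF partition_TL_comp]
  proof (intro conjI ballI impI)
    show "X \<subseteq> {1..m}" "Y \<subseteq> {1..t}" using R by blast+
    fix B v w assume B: "B \<in> TL_comp m n t a b" "v \<in> B" "w \<in> B" "v \<in> rows X Y"
    show "w \<in> rows X Y"
      using R[THEN conjunct2, THEN conjunct2, rule_format, OF B(4), of w]
        TL_comp_block[OF B(1,2), of w] B(3) by blast
  qed
qed

text \<open>
  The smallest choice of middle points. Closed loops of the product graph are left out, and this is
  what makes the parity argument for \<open>even_gap_middle\<close> work.
\<close>

definition middle ::
  "vertex set set \<Rightarrow> vertex set set \<Rightarrow> nat set \<Rightarrow> nat set \<Rightarrow> nat set" where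
  "middle a b X Y = {z. \<exists>v\<in>rows X Y. (outer v, PMiddle z) \<in> connected_in_product a b}"

lemma union_of_blocks_middle:
  assumes a: "pairing m n a" and b: "pairing n t b"
    and un: "union_of_blocks (TL_comp m n t a b) X Y"
  shows "union_of_blocks a X (middle a b X Y)" "union_of_blocks b (middle a b X Y) Y"
proof -
  let ?Z = "middle a b X Y"
  define R where "R q \<longleftrightarrow> (\<exists>v\<in>rows X Y. (outer v, q) \<in> connected_in_product a b)" for q
  have XY: "X \<subseteq> {1..m}" "Y \<subseteq> {1..t}" and cl: "\<And>v w. v \<in> rows X Y \<Longrightarrow> w \<in> vertices m t \<Longrightarrow>
      (outer v, outer w) \<in> connected_in_product a b \<Longrightarrow> w \<in> rows X Y"
    using un unfolding union_of_blocks_comp_iff by blast+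
  have ran: "in_rows {1..m} {1..n} {1..t} q" if r: "R q" for q
  proof -
    obtain v where v: "v \<in> rows X Y" "(outer v, q) \<in> connected_in_product a b"
      using r unfolding R_def by blast
    then show ?thesis using connected_in_range[OF a b rows_in_vertices[OF v(1) XY] v(2)] by simp
  qed
  have outer_R: "R (outer w) \<longleftrightarrow> w \<in> rows X Y" for w
  proof
    assume r: "R (outer w)"
    then have "w \<in> vertices m t" using ran[OF r] by (simp add: in_rows_simps vertices_rows)
    then show "w \<in> rows X Y" using r cl unfolding R_def by blast
  next
    assume "w \<in> rows X Y"
    then show "R (outer w)" unfolding R_def by (auto simp: connected_eq)
  qed
  have R: "R q \<longleftrightarrow> in_rows X ?Z Y q" for q
    using outer_R[of "Upper _"] outer_R[of "Lower _"]
    by (cases q) (simp_all add: R_def middle_def Upper_in_rows Lower_in_rows)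
  have Z: "?Z \<subseteq> {1..n}"
  proof
    fix z assume "z \<in> ?Z"
    then have "R (PMiddle z)" by (simp add: R_def middle_def)
    then show "z \<in> {1..n}" using ran by fastforce
  qed
  show "union_of_blocks a X ?Z"
    unfolding union_of_blocks_pairing_iff[OF a]
  proof (intro conjI allI impI XY Z)
    fix v w assume vw: "{v, w} \<in> a" "v \<in> rows X ?Z"
    then have "R (rename_first v)" by (simp only: R in_rows_simps)
    then have "R (rename_first w)" using connected_step(1)[OF _ vw(1)] unfolding R_def by blast
    then show "w \<in> rows X ?Z" by (simp only: R in_rows_simps)
  qed
  show "union_of_blocks b ?Z Y"
    unfolding union_of_blocks_pairing_iff[OF b]
  proof (intro conjI allI impI XY Z)
    fix v w assume vw: "{v, w} \<in> b" "v \<in> rows ?Z Y"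
    then have "R (rename_second v)" by (simp only: R in_rows_simps)
    then have "R (rename_second w)" using connected_step(2)[OF _ vw(1)] unfolding R_def by blast
    then show "w \<in> rows ?Z Y" by (simp only: R in_rows_simps)
  qed
qed

lemma connected_in_rows:
  assumes a: "pairing m n a" and b: "pairing n t b"
    and un: "union_of_blocks a X Z" "union_of_blocks b Z Y"
    and conn: "(p, q) \<in> connected_in_product a b" "in_rows X Z Y p"
  shows "in_rows X Z Y q"
  using conn(1)
proof (induction rule: connected_invariant)
  case (first v w)
  then show ?case using union_of_blocksD(3)[OF a un(1)] unfolding in_rows_simps by blast
next
  case (second v w)
  then show ?case using union_of_blocksD(3)[OF b un(2)] unfolding in_rows_simps by blast
next
  case base
  show ?case by fact
qed

text \<open>
  If \<open>X\<close>, \<open>Z\<close>, \<open>Y\<close> are compatible with both factors, then together they are closed under the edges of the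
  product graph, hence a union of components.
\<close>

lemma union_of_blocks_comp:
  assumes a: "pairing m n a" and b: "pairing n t b"
  shows "union_of_blocks (TL_comp m n t a b) X Y \<longleftrightarrow>
    (\<exists>Z. union_of_blocks a X Z \<and> union_of_blocks b Z Y)"
proof
  show "union_of_blocks (TL_comp m n t a b) X Y \<Longrightarrow> \<exists>Z. union_of_blocks a X Z \<and> union_of_blocks b Z Y"
    using union_of_blocks_middle[OF a b] by blast
next
  assume "\<exists>Z. union_of_blocks a X Z \<and> union_of_blocks b Z Y"
  then obtain Z where un: "union_of_blocks a X Z" "union_of_blocks b Z Y" by blast
  have "X \<subseteq> {1..m}" "Y \<subseteq> {1..t}"
    using union_of_blocksD[OF a un(1)] union_of_blocksD[OF b un(2)] by simp_all
  moreover have "w \<in> rows X Y" if "v \<in> rows X Y" "(outer v, outer w) \<in> connected_in_product a b" for v w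
    using connected_in_rows[OF a b un that(2)] that(1) unfolding in_rows_simps by blast
  ultimately show "union_of_blocks (TL_comp m n t a b) X Y"
    unfolding union_of_blocks_comp_iff by blast
qed

section \<open>Parity of gaps along a component of the product graph\<close>

fun row_gap :: "nat set \<Rightarrow> nat set \<Rightarrow> nat set \<Rightarrow> pvertex \<Rightarrow> nat" where
  "row_gap X Z Y (PUpper x) = card ({1..<x} - X)"
| "row_gap X Z Y (PMiddle x) = card ({1..<x} - Z)"
| "row_gap X Z Y (PLower x) = card ({1..<x} - Y)"

lemma row_gap_simps:
  "row_gap X Z Y (rename_first v) = gap X Z v"
  "row_gap X Z Y (rename_second v) = gap Z Y v"
  "row_gap X Z Y (outer v) = gap X Y v"
  by (cases v; simp)+

text \<open>
  The middle row is both the lower row of \<open>a\<close> and the upper row of \<open>b\<close>, and its gaps are counted the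
  same way in both, so the parities of the two layers fit together.
\<close>

lemma row_gap_parity:
  assumes a: "pairing m n a" "noncrossing a" and b: "pairing n t b" "noncrossing b"
    and un: "union_of_blocks a X Z" "union_of_blocks b Z Y"
    and conn: "(p, q) \<in> connected_in_product a b" "in_rows X Z Y p"
  shows "even (row_gap X Z Y p) = even (row_gap X Z Y q)"
proof -
  have "in_rows X Z Y q \<and> even (row_gap X Z Y p) = even (row_gap X Z Y q)"
    using conn(1)
  proof (induction rule: connected_invariant)
    case (first v w)
    then have v: "v \<in> rows X Z" by (simp add: in_rows_simps)
    then have "w \<in> rows X Z"
      using union_of_blocksD(3)[OF a(1) un(1)] first(1) by blast
    then show ?case
      using first(2) gap_parity_block[OF a un(1) first(1) v] by (simp add: row_gap_simps in_rows_simps)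
  next
    case (second v w)
    then have v: "v \<in> rows Z Y" by (simp add: in_rows_simps)
    then have "w \<in> rows Z Y"
      using union_of_blocksD(3)[OF b(1) un(2)] second(1) by blast
    then show ?case
      using second(2) gap_parity_block[OF b un(2) second(1) v] by (simp add: row_gap_simps in_rows_simps)
  next
    case base
    show ?case using conn(2) by simp
  qed
  then show ?thesis by blast
qed

section \<open>Blocks of a product are pairs\<close>

lemma edge_unique:
  assumes pair: "pairing m n a" and f: "inj f" and "(p, q) \<in> edge a f" "(p, q') \<in> edge a f"
  shows "q = q'"
proof -
  obtain v w where vw: "p = f v" "q = f w" "{v, w} \<in> a"
    using assms(3) unfolding edge_def by blast
  obtain v' w' where vw': "p = f v'" "q' = f w'" "{v', w'} \<in> a"
    using assms(4) unfolding edge_def by blast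
  have "v = v'" using f vw(1) vw'(1) by (simp add: inj_eq)
  then have "w = w'" using pairing_partner_unique[OF pair] vw vw' by simp
  then show ?thesis using vw vw' by simp
qed

fun is_upper :: "vertex \<Rightarrow> bool" where
  "is_upper (Upper x) = True"
| "is_upper (Lower x) = False"

definition layer_edge :: "vertex set set \<Rightarrow> vertex set set \<Rightarrow> bool \<Rightarrow> (pvertex \<times> pvertex) set" where
  "layer_edge a b s = (if s then edge a rename_first else edge b rename_second)"

lemma layer_edge_outer: "(outer v, q) \<in> layer_edge a b s \<Longrightarrow> s = is_upper v"
proof -
  assume e: "(outer v, q) \<in> layer_edge a b s"
  have "is_upper v" if "outer v = rename_first w" for w using that by (cases v; cases w) auto
  moreover have "\<not> is_upper v" if "outer v = rename_second w" for w using that by (cases v; cases w) auto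
  ultimately show ?thesis using e by (cases s) (auto simp: layer_edge_def edge_def)
qed

lemma layer_edge_unique:
  assumes "pairing m n a" "pairing n t b" "(p, q) \<in> layer_edge a b s" "(p, q') \<in> layer_edge a b s"
  shows "q = q'"
  using assms edge_unique[OF assms(1) inj_rename(1)] edge_unique[OF assms(2) inj_rename(2)]
  by (cases s) (auto simp: layer_edge_def)

lemma layer_edge_sym: "(p, q) \<in> layer_edge a b s \<Longrightarrow> (q, p) \<in> layer_edge a b s"
  unfolding layer_edge_def by (auto intro: symD[OF sym_edge])

text \<open>
  A state is a vertex together with the layer whose edge is to be used next: \<open>True\<close> for \<open>a\<close>, \<open>False\<close>
  for \<open>b\<close>. The layers alternate, because a middle vertex has one edge in each.
\<close>

definition walk :: "vertex set set \<Rightarrow> vertex set set \<Rightarrow> ((pvertex \<times> bool) \<times> (pvertex \<times> bool)) set" where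
  "walk a b = {((p, s), (q, \<not> s)) | p q s. (p, q) \<in> layer_edge a b s}"

lemma walk_iff: "((p, s), (q, r)) \<in> walk a b \<longleftrightarrow> r = (\<not> s) \<and> (p, q) \<in> layer_edge a b s"
  by (auto simp: walk_def)

lemma single_valued_walk:
  assumes "pairing m n a" "pairing n t b" shows "single_valued (walk a b)"
  by (rule single_valuedI) (auto simp: walk_iff dest: layer_edge_unique[OF assms])

text \<open>
  An outer vertex has an edge in one layer only, so the walk has no choice at its start. Every later
  state was entered through the edge of the other layer; hence both edges at each visited vertex
  are used, and the visited vertices form the whole component.
\<close>

lemma walk_reaches_component:
  assumes a: "pairing m n a" and b: "pairing n t b"
    and "(outer v, q) \<in> connected_in_product a b"
  shows "\<exists>s. ((outer v, is_upper v), (q, s)) \<in> (walk a b)\<^sup>*"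
proof -
  have "(outer v, q) \<in> (\<Union>s. layer_edge a b s)\<^sup>*"
  proof -
    have "(\<Union>s. layer_edge a b s) = edge a rename_first \<union> edge b rename_second"
      by (auto simp: layer_edge_def split: if_splits)
    then show ?thesis using assms(3) by (simp add: connected_eq)
  qed
  then show ?thesis
  proof (induction rule: rtrancl_induct)
    case base then show ?case by blast
  next
    case (step q q')
    then obtain s s' where s: "((outer v, is_upper v), (q, s)) \<in> (walk a b)\<^sup>*"
      and s': "(q, q') \<in> layer_edge a b s'" by blast
    show ?case
    proof (cases "s' = s")
      case True
      then have "((q, s), (q', \<not> s)) \<in> walk a b" using s' by (simp add: walk_iff)
      from rtrancl_into_rtrancl[OF s this] show ?thesis ..
    next
      case False
      from s show ?thesis
      proof (cases rule: rtranclE)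
        case base
        then show ?thesis using layer_edge_outer[of v q' a b s'] s' False by auto
      next
        case (step y)
        obtain p r where y: "y = (p, r)" by fastforce
        then have r: "r = s'" and "(p, q) \<in> layer_edge a b s'"
          using step(2) False by (auto simp: walk_iff)
        \<comment> \<open>The walk has entered \<open>q\<close> through the edge to \<open>q'\<close>, so it has already visited \<open>q'\<close>.\<close>
        then have "p = q'"
          using layer_edge_unique[OF a b layer_edge_sym s'] by blast
        then show ?thesis using step(1) y by blast
      qed
    qed
  qed
qed

text \<open>
  The walk is deterministic and stops at any outer vertex that it reaches after its start, so it reaches at
  most one.
\<close>

lemma at_most_two_outer:
  assumes a: "pairing m n a" and b: "pairing n t b"
    and c: "(outer v, outer w) \<in> connected_in_product a b" "(outer v, outer w') \<in> connected_in_product a b"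
    and ne: "w \<noteq> v" "w' \<noteq> v"
  shows "w = w'"
proof -
  let ?s = "(outer v, is_upper v)"
  have final: "\<exists>s. (?s, (outer w, s)) \<in> (walk a b)\<^sup>* \<and> (\<forall>y. ((outer w, s), y) \<notin> walk a b)"
    if c: "(outer v, outer w) \<in> connected_in_product a b" "w \<noteq> v" for w
  proof -
    obtain s where s: "(?s, (outer w, s)) \<in> (walk a b)\<^sup>*"
      using walk_reaches_component[OF a b c(1)] by blast
    moreover have "?s \<noteq> (outer w, s)" using c(2) inj_rename(3) by (auto simp: inj_eq)
    ultimately obtain p r where "((p, r), (outer w, s)) \<in> walk a b"
      by (metis rtranclE surj_pair)
    then have "s = (\<not> is_upper w)"
      using layer_edge_outer[OF layer_edge_sym, of p w a b r] by (auto simp: walk_iff)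
    then have "((outer w, s), y) \<notin> walk a b" for y
      using layer_edge_outer[of w "fst y" a b s] by (cases y) (auto simp: walk_iff)
    then show ?thesis using s by blast
  qed
  obtain s s' where s: "(?s, (outer w, s)) \<in> (walk a b)\<^sup>*" "\<And>y. ((outer w, s), y) \<notin> walk a b"
    and s': "(?s, (outer w', s')) \<in> (walk a b)\<^sup>*" "\<And>y. ((outer w', s'), y) \<notin> walk a b"
    using final[OF c(1) ne(1)] final[OF c(2) ne(2)] by blast
  have "((outer w, s), (outer w', s')) \<in> (walk a b)\<^sup>* \<or> ((outer w', s'), (outer w, s)) \<in> (walk a b)\<^sup>*"
    using single_valued_confluent[OF single_valued_walk[OF a b] s(1) s'(1)] .
  then have "(outer w, s) = (outer w', s')"
    using s(2) s'(2) by (metis converse_rtranclE)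
  then show ?thesis using inj_rename(3) by (simp add: inj_eq)
qed

lemma even_card_union_of_blocks:
  assumes "pairing m n a" "union_of_blocks a X Y"
  shows "even (card X + card Y)"
proof -
  note D = union_of_blocksD[OF assms]
  have "even (card (rows X Y))"
    by (rule even_card_closed[OF assms(1)]) (use D in \<open>auto simp: rows_subset_vertices\<close>)
  moreover have "finite X" "finite Y" using D finite_subset by blast+
  ultimately show ?thesis by (simp add: card_rows)
qed

lemma union_of_blocks_compl:
  assumes "pairing m n a" "union_of_blocks a X Y"
  shows "union_of_blocks a ({1..m} - X) ({1..n} - Y)"
proof -
  note D = union_of_blocksD[OF assms]
  have "w \<in> vertices m n - rows X Y" if vw: "{v, w} \<in> a" "v \<in> vertices m n - rows X Y" for v w
  proof -
    have "w \<in> vertices m n" using pairing_in_vertices[OF assms(1) vw(1)] by simp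
    moreover have "w \<notin> rows X Y" using D(3)[of w v] vw by (auto simp: insert_commute)
    ultimately show ?thesis by simp
  qed
  then show ?thesis
    unfolding union_of_blocks_pairing_iff[OF assms(1)] rows_diff by simp
qed

lemma union_of_blocks_block: "B \<in> a \<Longrightarrow> union_of_blocks a {x. Upper x \<in> B} {y. Lower y \<in> B}"
  unfolding union_of_blocks_rows rows_split[of B, symmetric] by (rule exI[of _ "{B}"]) simp

text \<open>
  A component has an even number of vertices in the upper two rows, which form a union of \<open>a\<close>-blocks,
  and in the lower two rows, which form a union of \<open>b\<close>-blocks. So it has an even number of outer
  vertices, and at most two of them by the walk.
\<close>

lemma pairing_TL_comp:
  assumes a: "pairing m n a" and b: "pairing n t b"
  shows "pairing m t (TL_comp m n t a b)"
  unfolding pairing_def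
proof (intro conjI ballI partition_TL_comp)
  fix B assume B: "B \<in> TL_comp m n t a b"
  define X Y where "X = {x. Upper x \<in> B}" and "Y = {y. Lower y \<in> B}"
  define Z where "Z = middle a b X Y"
  have BXY: "B = rows X Y" unfolding X_def Y_def by (rule rows_split)
  have un: "union_of_blocks (TL_comp m n t a b) X Y"
    using union_of_blocks_block[OF B] by (simp add: X_def Y_def)
  have u: "union_of_blocks a X Z" "union_of_blocks b Z Y"
    using union_of_blocks_middle[OF a b un] by (simp_all add: Z_def)
  have "even (card X + card Y)"
    using even_card_union_of_blocks[OF a u(1)] even_card_union_of_blocks[OF b u(2)] by simp
  moreover have fin: "finite X" "finite Y"
    using union_of_blocksD(1)[OF a u(1)] union_of_blocksD(2)[OF b u(2)] finite_subset by blast+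
  ultimately have even: "even (card B)" by (simp add: BXY card_rows)
  have fB: "finite B" unfolding BXY rows_def using fin by simp
  have "B \<noteq> {}" using partition_onD3[OF partition_TL_comp] B by blast
  then obtain v where v: "v \<in> B" by blast
  have "w = w'" if "w \<in> B - {v}" "w' \<in> B - {v}" for w w'
    using at_most_two_outer[OF a b, of v w w'] TL_comp_block[OF B v] that by blast
  then have "card (B - {v}) = 1 \<or> card (B - {v}) = 0"
    by (metis is_singletonI' is_singleton_altdef card.empty)
  moreover have "card B = Suc (card (B - {v}))" by (rule card.remove[OF fB v])
  ultimately show "card B = 2" using even by auto
qed

text \<open>
  Take all outer vertices except \<open>r\<close> and \<open>s\<close>. The gap parities at the connected vertices \<open>p\<close> and \<open>q\<close> agree,
  so the number of missing points between them is even. If the blocks interlaced, \<open>r\<close> would be the only one.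
\<close>

lemma noncrossing_TL_comp:
  assumes a: "pairing m n a" "noncrossing a" and b: "pairing n t b" "noncrossing b"
  shows "noncrossing (TL_comp m n t a b)"
  unfolding noncrossing_def
proof (rule notI, elim exE conjE)
  fix p q r s
  assume pq: "{p, q} \<in> TL_comp m n t a b" and rs: "{r, s} \<in> TL_comp m n t a b"
    and k: "key p < key r" "key r < key q" "key q < key s"
  note c = pairing_TL_comp[OF a(1) b(1)]
  define X Y where "X = {1..m} - {x. Upper x \<in> {r, s}}" and "Y = {1..t} - {y. Lower y \<in> {r, s}}"
  define Z where "Z = middle a b X Y"
  have un: "union_of_blocks (TL_comp m n t a b) X Y"
    using union_of_blocks_compl[OF c union_of_blocks_block[OF rs]] by (simp add: X_def Y_def)
  have u: "union_of_blocks a X Z" "union_of_blocks b Z Y"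
    using union_of_blocks_middle[OF a(1) b(1) un] by (simp_all add: Z_def)
  have XY: "rows X Y = vertices m t - {r, s}"
    unfolding X_def Y_def rows_diff[symmetric] rows_split[symmetric] ..
  have V: "p \<in> vertices m t" "q \<in> vertices m t" "r \<in> vertices m t" "s \<in> vertices m t"
    using pairing_in_vertices[OF c] pq rs by blast+
  then have pqr: "p \<in> rows X Y" "q \<in> rows X Y"
    using k unfolding XY by auto
  have "(outer p, outer q) \<in> connected_in_product a b"
    using TL_comp_block[OF pq, of p q] by simp
  then have "even (gap X Y p) = even (gap X Y q)"
    using row_gap_parity[OF a b u, of "outer p" "outer q"] pqr by (simp add: in_rows_simps row_gap_simps)
  moreover have "X \<subseteq> {1..m}" "Y \<subseteq> {1..t}" by (auto simp: X_def Y_def)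
  ultimately have "even (card {u \<in> vertices m t - rows X Y.
      key p < key u \<and> key u < key q \<or> key q < key u \<and> key u < key p})"
    using gap_parity_between[OF _ _ pqr] by simp
  moreover have "{u \<in> vertices m t - rows X Y.
      key p < key u \<and> key u < key q \<or> key q < key u \<and> key u < key p} = {r}"
    using k V unfolding XY by auto
  ultimately show False by simp
qed

section \<open>The Temperley--Lieb category\<close>

text \<open>
  The blocks are the minimal nonempty unions of blocks.
\<close>

lemma partition_eq_if_unions_eq:
  assumes a: "partition_on (vertices m n) a" and b: "partition_on (vertices m n) b"
    and eq: "\<And>X Y. union_of_blocks a X Y \<longleftrightarrow> union_of_blocks b X Y"
  shows "a = b"
proof -
  have sub: "a \<subseteq> b" if a: "partition_on (vertices m n) a" and b: "partition_on (vertices m n) b"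
    and eq: "\<And>X Y. union_of_blocks a X Y \<longleftrightarrow> union_of_blocks b X Y" for a b
  proof
    fix B assume B: "B \<in> a"
    have un: "\<exists>S\<subseteq>b. C = \<Union>S" if "C \<in> a" for C
      using union_of_blocks_block[OF that] eq[of "{x. Upper x \<in> C}" "{y. Lower y \<in> C}"]
      unfolding union_of_blocks_rows rows_split[symmetric] by simp
    have un': "\<exists>S\<subseteq>a. C = \<Union>S" if "C \<in> b" for C
      using union_of_blocks_block[OF that] eq[of "{x. Upper x \<in> C}" "{y. Lower y \<in> C}"]
      unfolding union_of_blocks_rows rows_split[symmetric] by simp
    obtain S where S: "S \<subseteq> b" "B = \<Union>S" using un[OF B] by blast
    have "B \<noteq> {}" using B partition_onD3[OF a] by blast
    then obtain C where C: "C \<in> S" using S by blast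
    obtain T where T: "T \<subseteq> a" "C = \<Union>T" using un' C S by blast
    have "C \<noteq> {}" using C S partition_onD3[OF b] by blast
    then obtain D where D: "D \<in> T" using T by blast
    have "D \<noteq> {}" "D \<in> a" using D T partition_onD3[OF a] by blast+
    moreover have "D \<subseteq> C" "C \<subseteq> B" using C D S T by blast+
    ultimately have "D = B"
      using B partition_onD2[OF a] unfolding disjoint_def by blast
    then have "B = C" using \<open>D \<subseteq> C\<close> \<open>C \<subseteq> B\<close> by blast
    then show "B \<in> b" using C S by blast
  qed
  show ?thesis using sub[OF a b eq] sub[OF b a eq[symmetric]] by blast
qed

text \<open>
  Both sides have the same unions of blocks, because composition of relations is associative.
\<close>

lemma TL_comp_assoc:
  assumes a: "pairing w x a" and b: "pairing x y b" and c: "pairing y z c"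
  shows "TL_comp w y z (TL_comp w x y a b) c = TL_comp w x z a (TL_comp x y z b c)"
proof (rule partition_eq_if_unions_eq[OF partition_TL_comp partition_TL_comp])
  show "union_of_blocks (TL_comp w y z (TL_comp w x y a b) c) X Y \<longleftrightarrow>
        union_of_blocks (TL_comp w x z a (TL_comp x y z b c)) X Y" for X Y
    unfolding union_of_blocks_comp[OF pairing_TL_comp[OF a b] c]
      union_of_blocks_comp[OF a pairing_TL_comp[OF b c]]
      union_of_blocks_comp[OF a b] union_of_blocks_comp[OF b c] by blast
qed

lemma pairingI:
  assumes "\<And>B. B \<in> a \<Longrightarrow> card B = 2" "\<And>B. B \<in> a \<Longrightarrow> B \<subseteq> vertices m n"
    and "\<And>v. v \<in> vertices m n \<Longrightarrow> \<exists>B\<in>a. v \<in> B"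
    and "\<And>B C v. B \<in> a \<Longrightarrow> C \<in> a \<Longrightarrow> v \<in> B \<Longrightarrow> v \<in> C \<Longrightarrow> B = C"
  shows "pairing m n a"
  unfolding pairing_def
proof (intro conjI ballI partition_onI assms(1))
  show "{} \<notin> a" using assms(1)[of "{}"] by auto
  show "\<Union>a = vertices m n" using assms(2,3) by blast
  show "disjnt p q" if "p \<in> a" "q \<in> a" "p \<noteq> q" for p q
    using assms(4)[of p q] that unfolding disjnt_def by blast
qed

lemma TL_ident_pair: "{v, w} \<in> TL_ident n \<longleftrightarrow>
    (\<exists>i\<in>{1..n}. v = Upper i \<and> w = Lower i \<or> v = Lower i \<and> w = Upper i)"
  unfolding TL_ident_def image_iff by (simp add: doubleton_eq_iff)

lemma pairing_TL_ident: "pairing n n (TL_ident n)"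
proof (rule pairingI)
  fix v assume "v \<in> vertices n n"
  then show "\<exists>B\<in>TL_ident n. v \<in> B"
    by (cases v) (auto simp: TL_ident_def)
qed (auto simp: TL_ident_def)

lemma noncrossing_TL_ident: "noncrossing (TL_ident n)"
  unfolding noncrossing_def TL_ident_pair by auto

lemma union_of_blocks_ident: "union_of_blocks (TL_ident n) X Y \<longleftrightarrow> X = Y \<and> X \<subseteq> {1..n}"
proof -
  have "(\<forall>v w. {v, w} \<in> TL_ident n \<longrightarrow> v \<in> rows X Y \<longrightarrow> w \<in> rows X Y) \<longleftrightarrow>
     (\<forall>i\<in>{1..n}. i \<in> X \<longleftrightarrow> i \<in> Y)" (is "?L \<longleftrightarrow> ?R")
  proof
    assume L: ?L
    show ?R
    proof
      fix i assume "i \<in> {1..n}"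
      then have "{Upper i, Lower i} \<in> TL_ident n" "{Lower i, Upper i} \<in> TL_ident n"
        by (auto simp: TL_ident_pair)
      then show "i \<in> X \<longleftrightarrow> i \<in> Y"
        using L[rule_format, of "Upper i" "Lower i"] L[rule_format, of "Lower i" "Upper i"] by auto
    qed
  next
    assume ?R then show ?L by (auto simp: TL_ident_pair)
  qed
  then show ?thesis
    unfolding union_of_blocks_pairing_iff[OF pairing_TL_ident] by auto
qed

lemma TL_comp_ident:
  assumes a: "pairing m n a"
  shows "TL_comp m m n (TL_ident m) a = a" "TL_comp m n n a (TL_ident n) = a"
proof -
  note D = union_of_blocksD(1,2)[OF a]
  show "TL_comp m m n (TL_ident m) a = a"
  proof (rule partition_eq_if_unions_eq[OF partition_TL_comp pairing_partition[OF a]])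
    show "union_of_blocks (TL_comp m m n (TL_ident m) a) X Y \<longleftrightarrow> union_of_blocks a X Y" for X Y
      unfolding union_of_blocks_comp[OF pairing_TL_ident a] union_of_blocks_ident using D by blast
  qed
  show "TL_comp m n n a (TL_ident n) = a"
  proof (rule partition_eq_if_unions_eq[OF partition_TL_comp pairing_partition[OF a]])
    show "union_of_blocks (TL_comp m n n a (TL_ident n)) X Y \<longleftrightarrow> union_of_blocks a X Y" for X Y
      unfolding union_of_blocks_comp[OF a pairing_TL_ident] union_of_blocks_ident using D by blast
  qed
qed

lemma swap_swap [simp]: "swap_vertex (swap_vertex v) = v"
  by (cases v) auto

lemma swap_image_swap [simp]: "swap_vertex ` swap_vertex ` B = B"
  by (simp add: image_image)

lemma TL_star_star: "TL_star (TL_star a) = a"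
  by (simp add: TL_star_def image_image)

lemma TL_star_iff: "B \<in> TL_star a \<longleftrightarrow> swap_vertex ` B \<in> a"
  unfolding TL_star_def by (metis imageE imageI swap_image_swap)

lemma key_swap [simp]: "key (swap_vertex v) = - key v"
  by (cases v) auto

lemma swap_in_vertices [simp]: "swap_vertex v \<in> vertices m n \<longleftrightarrow> v \<in> vertices n m"
  by (cases v) auto

lemma swap_in_rows [simp]: "swap_vertex v \<in> rows X Y \<longleftrightarrow> v \<in> rows Y X"
  by (cases v) auto

lemma inj_swap: "inj swap_vertex"
  by (metis injI swap_swap)

lemma pairing_TL_star:
  assumes a: "pairing m n a" shows "pairing n m (TL_star a)"
proof (rule pairingI)
  fix B assume "B \<in> TL_star a"
  then have B: "swap_vertex ` B \<in> a" by (simp add: TL_star_iff)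
  then have "card (swap_vertex ` B) = 2" using a by (auto simp: pairing_def)
  then show "card B = 2" by (simp add: card_image inj_on_subset[OF inj_swap])
  show "B \<subseteq> vertices n m"
  proof
    fix v assume "v \<in> B"
    then have "swap_vertex v \<in> vertices m n" using pairing_in_vertices[OF a B] by blast
    then show "v \<in> vertices n m" by simp
  qed
next
  fix v assume "v \<in> vertices n m"
  then have "swap_vertex v \<in> vertices m n" by simp
  then obtain w where w: "{swap_vertex v, w} \<in> a" using pairing_partner[OF a] by blast
  then have "{v, swap_vertex w} \<in> TL_star a" by (simp add: TL_star_iff)
  then show "\<exists>B\<in>TL_star a. v \<in> B" by blast
next
  fix B C v assume B: "B \<in> TL_star a" "C \<in> TL_star a" "v \<in> B" "v \<in> C"
  then have "swap_vertex ` B = swap_vertex ` C"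
    using pairing_block_unique[OF a, of _ _ "swap_vertex v"] by (simp add: TL_star_iff)
  then show "B = C" using inj_swap by (simp add: inj_image_eq_iff)
qed

lemma noncrossing_TL_star:
  assumes "noncrossing a" shows "noncrossing (TL_star a)"
  unfolding noncrossing_def
proof (rule notI, elim exE conjE)
  fix p q r s
  assume "{p, q} \<in> TL_star a" "{r, s} \<in> TL_star a" "key p < key r" "key r < key q" "key q < key s"
  then show False
    using noncrossingD[OF assms, of "swap_vertex s" "swap_vertex r" "swap_vertex q" "swap_vertex p"]
    by (simp add: TL_star_iff insert_commute)
qed

lemma union_of_blocks_star:
  assumes a: "pairing m n a"
  shows "union_of_blocks (TL_star a) X Y \<longleftrightarrow> union_of_blocks a Y X"
proof -
  have "(\<forall>v w. {v, w} \<in> TL_star a \<longrightarrow> v \<in> rows X Y \<longrightarrow> w \<in> rows X Y) \<longleftrightarrow>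
     (\<forall>v w. {v, w} \<in> a \<longrightarrow> v \<in> rows Y X \<longrightarrow> w \<in> rows Y X)" (is "?L \<longleftrightarrow> ?R")
  proof
    assume L: ?L
    show ?R
    proof (intro allI impI)
      fix v w assume "{v, w} \<in> a" "v \<in> rows Y X"
      then show "w \<in> rows Y X"
        using L[rule_format, of "swap_vertex v" "swap_vertex w"] by (simp add: TL_star_iff)
    qed
  next
    assume R: ?R
    show ?L
    proof (intro allI impI)
      fix v w assume "{v, w} \<in> TL_star a" "v \<in> rows X Y"
      then show "w \<in> rows X Y"
        using R[rule_format, of "swap_vertex v" "swap_vertex w"] by (simp add: TL_star_iff)
    qed
  qed
  then show ?thesis
    unfolding union_of_blocks_pairing_iff[OF a] union_of_blocks_pairing_iff[OF pairing_TL_star[OF a]]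
    by auto
qed

lemma category_TL: "category TL"
  by unfold_locales
    (auto simp: TL_def TL_hom_iff TL_comp_assoc TL_comp_ident TL_star_star pairing_TL_comp
      noncrossing_TL_comp pairing_TL_ident noncrossing_TL_ident pairing_TL_star noncrossing_TL_star)

section \<open>Even-gap subsets\<close>

text \<open>
  The parity form of the even-gap condition, which fits the gap counts above: an even number of
  missing points in total, and an even number before each member.
\<close>

definition even_gap :: "nat \<Rightarrow> nat set \<Rightarrow> bool" where
  "even_gap n X \<longleftrightarrow>
     X \<subseteq> {1..n} \<and> even (card ({1..n} - X)) \<and> (\<forall>x\<in>X. even (card ({1..<x} - X)))"

lemma even_card_Union_even:
  assumes "disjoint P" "Q \<subseteq> P" "\<And>I. I \<in> P \<Longrightarrow> finite I \<and> even (card I)"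
  shows "even (card (\<Union>Q))"
proof -
  have "card (\<Union>Q) = sum card Q"
  proof (rule card_Union_disjoint)
    show "pairwise disjnt Q"
      using assms(1,2) unfolding disjoint_def pairwise_def disjnt_def by blast
    show "finite I" if "I \<in> Q" for I using assms(2,3) that by blast
  qed
  also have "even \<dots>" using assms(2,3) by (intro dvd_sum) blast
  finally show ?thesis .
qed

text \<open>
  An interval that avoids \<open>x\<close> is on one side of it, so the missing points before \<open>x\<close> are again a
  union of even intervals.
\<close>

lemma even_gap_if_intervals:
  assumes X: "X \<subseteq> {1..n}" and P: "partition_on ({1..n} - X) P"
    and I: "\<And>I. I \<in> P \<Longrightarrow> (\<exists>i j. I = {i..j}) \<and> even (card I)"
  shows "even_gap n X"
  unfolding even_gap_def
proof (intro conjI ballI X)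
  have fin: "finite I \<and> even (card I)" if "I \<in> P" for I
    using I[OF that] by auto
  note ev = even_card_Union_even[OF partition_onD2[OF P] _ fin]
  show "even (card ({1..n} - X))"
    using ev[of P] partition_onD1[OF P] by simp
  fix x assume x: "x \<in> X"
  have "{1..<x} - X = \<Union>{I \<in> P. I \<subseteq> {..<x}}"
  proof
    show "{1..<x} - X \<subseteq> \<Union>{I \<in> P. I \<subseteq> {..<x}}"
    proof
      fix y assume y: "y \<in> {1..<x} - X"
      then have "y \<in> {1..n} - X" using x X by force
      then have "y \<in> \<Union>P" unfolding partition_onD1[OF P] .
      then obtain J where J: "J \<in> P" "y \<in> J" by blast
      obtain i j where ij: "J = {i..j}" using I[OF J(1)] by blast
      have "x \<notin> J" using J(1) x partition_onD1[OF P] by blast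
      then have "J \<subseteq> {..<x}" using y J(2) ij by auto
      then show "y \<in> \<Union>{I \<in> P. I \<subseteq> {..<x}}" using J by blast
    qed
    show "\<Union>{I \<in> P. I \<subseteq> {..<x}} \<subseteq> {1..<x} - X"
    proof
      fix y assume "y \<in> \<Union>{I \<in> P. I \<subseteq> {..<x}}"
      then have "y \<in> \<Union>P" "y < x" by auto
      then show "y \<in> {1..<x} - X" using partition_onD1[OF P] by auto
    qed
  qed
  then show "even (card ({1..<x} - X))" using ev[of "{I \<in> P. I \<subseteq> {..<x}}"] by auto
qed

lemma even_gap_0: "even_gap 0 X \<longleftrightarrow> X = {}"
  by (auto simp: even_gap_def)

lemma even_gap_Suc_mem:
  assumes "Suc k \<in> X" shows "even_gap (Suc k) X \<longleftrightarrow> even_gap k (X - {Suc k})"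
proof -
  have c: "{1..k} - (X - {Suc k}) = {1..<Suc k} - X" "{1..Suc k} - X = {1..<Suc k} - X"
    using assms by (auto simp: le_Suc_eq)
  have d: "{1..<x} - (X - {Suc k}) = {1..<x} - X" if "x \<le> Suc k" for x
    using that by auto
  have s: "X - {Suc k} \<subseteq> {1..k} \<longleftrightarrow> X \<subseteq> {1..Suc k}"
  proof -
    have "{1..Suc k} = insert (Suc k) {1..k}" by auto
    then show ?thesis by (simp only: Diff_subset_conv) blast
  qed
  show ?thesis
    unfolding even_gap_def c s
  proof (intro conj_cong refl)
    assume X: "X \<subseteq> {1..Suc k}" and e: "even (card ({1..<Suc k} - X))"
    show "(\<forall>x\<in>X. even (card ({1..<x} - X))) \<longleftrightarrow>
      (\<forall>x\<in>X - {Suc k}. even (card ({1..<x} - (X - {Suc k}))))"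
      using X e d by (metis Diff_iff atLeastAtMost_iff insertE insertI1 singletonD subsetD)
  qed
qed

text \<open>
  The last gap is nonempty and even, so it contains the last two points. With \<open>even_gap_Suc_mem\<close> and
  \<open>even_gap_Suc_Suc\<close> this is the Fibonacci recursion.
\<close>

lemma even_gap_Suc_notin:
  assumes "Suc k \<notin> X" "even_gap (Suc k) X"
  shows "\<exists>j. k = Suc j \<and> Suc j \<notin> X \<and> even_gap j X"
proof -
  have X: "X \<subseteq> {1..k}" using assms by (auto simp: even_gap_def le_Suc_eq)
  have "{1..Suc k} - X = insert (Suc k) ({1..k} - X)" using assms(1) by auto
  then have odd: "odd (card ({1..k} - X))" using assms(2) by (simp add: even_gap_def)
  then obtain j where j: "k = Suc j" by (cases k) auto
  have nj: "Suc j \<notin> X"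
  proof
    assume "Suc j \<in> X"
    then have "even (card ({1..<Suc j} - X))" using assms(2) by (simp add: even_gap_def)
    moreover have "{1..<Suc j} - X = {1..k} - X" using \<open>Suc j \<in> X\<close> j by (auto simp: le_Suc_eq)
    ultimately show False using odd by simp
  qed
  have "{1..k} - X = insert (Suc j) ({1..j} - X)" using nj j by auto
  then have "even (card ({1..j} - X))" using odd by simp
  moreover have "X \<subseteq> {1..j}" using X nj j by (auto simp: le_Suc_eq)
  ultimately show ?thesis using j nj assms(2) by (auto simp: even_gap_def)
qed

lemma even_gap_Suc_Suc: 
  assumes "even_gap j X" shows "even_gap (Suc (Suc j)) X"
proof -
  have X: "X \<subseteq> {1..j}" using assms by (simp add: even_gap_def)
  then have "{1..Suc (Suc j)} - X = insert (Suc (Suc j)) (insert (Suc j) ({1..j} - X))"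
    by auto
  then show ?thesis using assms by (auto simp: even_gap_def)
qed

lemma even_gap_intervals:
  "even_gap n X \<Longrightarrow> \<exists>P. partition_on ({1..n} - X) P \<and> (\<forall>I\<in>P. (\<exists>i j. I = {i..j}) \<and> even (card I))"
proof (induction n arbitrary: X rule: less_induct)
  case (less n)
  show ?case
  proof (cases n)
    case 0
    then show ?thesis by (intro exI[of _ "{}"]) (simp add: partition_on_empty)
  next
    case n: (Suc k)
    show ?thesis
    proof (cases "Suc k \<in> X")
      case True
      then have "even_gap k (X - {Suc k})" using less.prems n even_gap_Suc_mem by simp
      moreover have "{1..k} - (X - {Suc k}) = {1..n} - X"
        using True n by (auto simp: le_Suc_eq)
      ultimately show ?thesis using less.IH[of k "X - {Suc k}"] n by simp
    next
      case False
      then obtain j where j: "k = Suc j" "Suc j \<notin> X" "even_gap j X"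
        using even_gap_Suc_notin less.prems n by blast
      obtain P where P: "partition_on ({1..j} - X) P" "\<And>I. I \<in> P \<Longrightarrow> (\<exists>i j. I = {i..j}) \<and> even (card I)"
        using less.IH[of j X] j n by auto
      let ?I = "{Suc j..Suc (Suc j)}"
      have "\<Union>P \<subseteq> {1..j}"
        unfolding partition_onD1[OF P(1), symmetric] by blast
      then have "disjnt ?I (\<Union>P)" unfolding disjnt_iff by fastforce
      moreover have "{1..n} - X - ?I = {1..j} - X" "?I \<subseteq> {1..n} - X" "?I \<noteq> {}"
        using j False n by (auto simp: le_Suc_eq)
      ultimately have "partition_on ({1..n} - X) (insert ?I P)"
        using partition_on_insert[of ?I P "{1..n} - X"] P(1) by simp
      moreover have "\<forall>I\<in>insert ?I P. (\<exists>i j. I = {i..j}) \<and> even (card I)"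
        using P(2) by auto
      ultimately show ?thesis by blast
    qed
  qed
qed

lemma even_gap_subsets_eq: "even_gap_subsets n = {X. even_gap n X}"
proof (intro Set.set_eqI iffI)
  fix X assume "X \<in> even_gap_subsets n"
  then show "X \<in> {X. even_gap n X}"
    unfolding even_gap_subsets_def using even_gap_if_intervals by auto
next
  fix X assume "X \<in> {X. even_gap n X}"
  then show "X \<in> even_gap_subsets n"
    unfolding even_gap_subsets_def using even_gap_intervals[of n X] by (simp add: even_gap_def)
qed

lemma finite_even_gap: "finite {X. even_gap n X}"
  by (rule finite_subset[of _ "Pow {1..n}"]) (auto simp: even_gap_def)

lemma card_even_gap_subsets: "card (even_gap_subsets n) = fibo n"
  unfolding even_gap_subsets_eq
proof (induction n rule: fib.induct)
  case 1
  then show ?case by (simp add: even_gap_0 fibo_def)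
next
  case 2
  have "{X. even_gap (Suc 0) X} = {{1}}"
  proof (intro Set.set_eqI iffI)
    fix X assume "X \<in> {X. even_gap (Suc 0) X}"
    then have X: "even_gap (Suc 0) X" by simp
    then have "Suc 0 \<in> X" using even_gap_Suc_notin[of 0 X] by auto
    then show "X \<in> {{1}}" using X by (auto simp: even_gap_def)
  qed (auto simp: even_gap_def)
  then show ?case by (simp add: fibo_def)
next
  case (3 n)
  let ?E = "\<lambda>n. {X. even_gap n X}"
  have "?E (Suc (Suc n)) = insert (Suc (Suc n)) ` ?E (Suc n) \<union> ?E n"
  proof (intro Set.set_eqI iffI)
    fix X assume X: "X \<in> ?E (Suc (Suc n))"
    show "X \<in> insert (Suc (Suc n)) ` ?E (Suc n) \<union> ?E n"
    proof (cases "Suc (Suc n) \<in> X")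
      case True
      then have "X = insert (Suc (Suc n)) (X - {Suc (Suc n)})" by blast
      then show ?thesis using X even_gap_Suc_mem[OF True] by blast
    next
      case False
      then show ?thesis using X even_gap_Suc_notin[OF False] by auto
    qed
  next
    fix X assume "X \<in> insert (Suc (Suc n)) ` ?E (Suc n) \<union> ?E n"
    then consider Y where "X = insert (Suc (Suc n)) Y" "even_gap (Suc n) Y" | "even_gap n X" by blast
    then show "X \<in> ?E (Suc (Suc n))"
    proof cases
      case 1
      then have "Suc (Suc n) \<notin> Y" by (auto simp: even_gap_def)
      then have "X - {Suc (Suc n)} = Y" using 1 by auto
      then show ?thesis using even_gap_Suc_mem[of "Suc n" X] 1 by simp
    next
      case 2
      then show ?thesis using even_gap_Suc_Suc by simp
    qed
  qed
  moreover have "card (insert (Suc (Suc n)) ` ?E (Suc n) \<union> ?E n)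
      = card (insert (Suc (Suc n)) ` ?E (Suc n)) + card (?E n)"
    by (intro card_Un_disjoint finite_imageI finite_even_gap) (auto simp: even_gap_def)
  moreover have "card (insert (Suc (Suc n)) ` ?E (Suc n)) = card (?E (Suc n))"
  proof (rule card_image, rule inj_onI)
    fix X Y assume "X \<in> ?E (Suc n)" "Y \<in> ?E (Suc n)" and eq: "insert (Suc (Suc n)) X = insert (Suc (Suc n)) Y"
    then have "Suc (Suc n) \<notin> X" "Suc (Suc n) \<notin> Y" by (auto simp: even_gap_def)
    then show "X = Y" using eq by (simp add: insert_ident)
  qed
  ultimately show ?case using 3 by (simp add: fibo_def)
qed

section \<open>Unions of blocks of a product on even-gap subsets\<close>

text \<open>
  Every chosen middle point is connected to a point of \<open>rows X Y\<close>, where the gap is even.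
\<close>

lemma even_gap_middle:
  assumes a: "pairing m n a" "noncrossing a" and b: "pairing n t b" "noncrossing b"
    and un: "union_of_blocks (TL_comp m n t a b) X Y" and X: "even_gap m X" and Y: "even_gap t Y"
  shows "even_gap n (middle a b X Y)"
proof -
  let ?Z = "middle a b X Y"
  note u = union_of_blocks_middle[OF a(1) b(1) un]
  have Z: "?Z \<subseteq> {1..n}" by (rule union_of_blocksD(2)[OF a(1) u(1)])
  have "even (card ({1..m} - X) + card ({1..n} - ?Z))"
    by (rule even_card_union_of_blocks[OF a(1) union_of_blocks_compl[OF a(1) u(1)]])
  then have "even (card ({1..n} - ?Z))" using X by (simp add: even_gap_def)
  moreover have "even (card ({1..<z} - ?Z))" if z: "z \<in> ?Z" for z
  proof -
    obtain v where v: "v \<in> rows X Y" "(outer v, PMiddle z) \<in> connected_in_product a b"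
      using z unfolding middle_def by blast
    have "even (row_gap X ?Z Y (outer v)) = even (row_gap X ?Z Y (PMiddle z))"
      by (rule row_gap_parity[OF a b u v(2)]) (simp add: in_rows_simps v(1))
    moreover have "even (gap X Y v)"
      using v(1) X Y by (cases v) (auto simp: even_gap_def)
    ultimately show ?thesis by (simp add: row_gap_simps)
  qed
  ultimately show ?thesis using Z by (simp add: even_gap_def)
qed

text \<open>
  The multiplicativity of the matrices, for one pair of indices.
\<close>

lemma union_of_blocks_comp_even_gap:
  assumes a: "pairing m n a" "noncrossing a" and b: "pairing n t b" "noncrossing b"
    and X: "even_gap m X" and Y: "even_gap t Y"
  shows "union_of_blocks (TL_comp m n t a b) X Y \<longleftrightarrow>
    (\<exists>Z. even_gap n Z \<and> union_of_blocks a X Z \<and> union_of_blocks b Z Y)"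
  using union_of_blocks_comp[OF a(1) b(1)] even_gap_middle[OF a b _ X Y]
    union_of_blocks_middle[OF a(1) b(1)] by blast

section \<open>Recovering a noncrossing pairing from even-gap unions of blocks\<close>

text \<open>
  For a block: the point \<open>k\<close> of the line lies under its arc. In particular \<open>spans C 0\<close> says that \<open>C\<close>
  joins the two rows.
\<close>

definition spans :: "vertex set \<Rightarrow> int \<Rightarrow> bool" where
  "spans C k \<longleftrightarrow> (\<exists>p\<in>C. \<exists>q\<in>C. key p < k \<and> k < key q)"

lemma spans_block:
  assumes pair: "pairing m n a" and nc: "noncrossing a"
    and "C \<in> a" "D \<in> a" "C \<noteq> D" "u \<in> C" "spans D (key u)" "u' \<in> C"
  shows "spans D (key u')"
proof -
  obtain p q where pq: "p \<in> D" "q \<in> D" "key p < key u" "key u < key q"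
    using assms(7) by (auto simp: spans_def)
  obtain w where w: "D = {p, w}" using pairing_block[OF pair \<open>D \<in> a\<close> pq(1)] .
  moreover have "p \<noteq> q" using pq(3,4) by auto
  ultimately have D: "D = {p, q}" using pq(2) by auto
  have "{p, q} \<in> a" "C \<noteq> {p, q}" using assms(4,5) D by simp_all
  then have "key p < key u' \<and> key u' < key q"
    using noncrossing_inside[OF pair nc \<open>C \<in> a\<close> \<open>u \<in> C\<close> \<open>u' \<in> C\<close> _ _ pq(3,4)] by simp
  then show ?thesis unfolding spans_def using pq(1,2) by blast
qed

lemma spans_trans: "(\<And>u. u \<in> C \<Longrightarrow> spans D (key u)) \<Longrightarrow> spans C k \<Longrightarrow> spans D k"
  unfolding spans_def by (meson less_trans)

text \<open>
  The blocks that are left out stay within one row and do not enclose any point of the chosen blocks.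
  So to the left of a chosen point, and also in each row as a whole, the missing points come in
  complete blocks.
\<close>

lemma even_gap_upward_closed:
  assumes pair: "pairing m n a" and S: "S \<subseteq> a"
    and through: "\<And>C. C \<in> a \<Longrightarrow> spans C 0 \<Longrightarrow> C \<in> S"
    and closed: "\<And>C D u. C \<in> S \<Longrightarrow> u \<in> C \<Longrightarrow> D \<in> a \<Longrightarrow> spans D (key u) \<Longrightarrow> D \<in> S"
    and X: "X = {x. Upper x \<in> \<Union>S}" and Y: "Y = {y. Lower y \<in> \<Union>S}"
  shows "even_gap m X \<and> even_gap n Y \<and> union_of_blocks a X Y"
proof -
  have R: "rows X Y = \<Union>S" unfolding X Y by (rule rows_split[symmetric])
  have un: "union_of_blocks a X Y" unfolding union_of_blocks_rows R using S by blast
  note D = union_of_blocksD[OF pair un]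
  have co: "v' \<notin> rows X Y" if "{v, v'} \<in> a" "v \<notin> rows X Y" for v v'
    using D(3)[of v' v] that by (auto simp: insert_commute)
  \<comment> \<open>A missing block does not join the two rows.\<close>
  have nospan0: "key v < 0 \<longleftrightarrow> key v' < 0" if "{v, v'} \<in> a" "v \<notin> rows X Y" for v v'
  proof -
    have "\<not> spans {v, v'} 0" using through[OF that(1)] that(2) unfolding R by auto
    moreover have "key v \<noteq> 0" "key v' \<noteq> 0"
      using key_nonzero pairing_in_vertices[OF pair that(1)] by auto
    ultimately show ?thesis by (auto simp: spans_def)
  qed
  have gap: "even (gap X Y u)" if u: "u \<in> rows X Y" for u
  proof -
    have uV: "u \<in> vertices m n" using rows_in_vertices[OF u D(1,2)] .
    let ?A = "{z \<in> vertices m n - rows X Y. 0 < key z \<and> key z < key u \<or> key u < key z \<and> key z < 0}"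
    have "even (card ?A)"
    proof (rule even_card_closed[OF pair])
      fix z z' assume z: "{z, z'} \<in> a" "z \<in> ?A"
      have z': "z' \<notin> rows X Y" using co z by blast
      have V: "z' \<in> vertices m n" using pairing_in_vertices[OF pair z(1)] by blast
      have ne: "key z' \<noteq> key u" using key_inj[OF _ V uV] z' u by blast
      have "\<not> spans {z, z'} (key u)"
      proof
        assume sp: "spans {z, z'} (key u)"
        obtain C where "C \<in> S" "u \<in> C" using u unfolding R by blast
        then have "{z, z'} \<in> S" using closed[OF _ _ z(1) sp] by blast
        then show False using z' unfolding R by blast
      qed
      then have "\<not> (key z < key u \<and> key u < key z')" "\<not> (key z' < key u \<and> key u < key z)"
        by (auto simp: spans_def)
      moreover have "key z < 0 \<longleftrightarrow> key z' < 0" using nospan0[OF z(1)] z(2) by blast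
      moreover have "key z' \<noteq> 0" using key_nonzero[OF V] .
      ultimately show "z' \<in> ?A" using z(2) z' V ne by auto
    qed blast
    then show ?thesis using gap_eq_card[OF uV] by simp
  qed
  have X1: "even (card ({1..m} - X))"
  proof -
    have "even (card (Upper ` ({1..m} - X)))"
    proof (rule even_card_closed[OF pair])
      fix v w assume v: "{v, w} \<in> a" "v \<in> Upper ` ({1..m} - X)"
      then have "v \<notin> rows X Y" "key v < 0" by auto
      then have "w \<notin> rows X Y" "key w < 0" using co nospan0 v(1) by blast+
      moreover have "w \<in> vertices m n" using pairing_in_vertices[OF pair v(1)] by blast
      ultimately show "w \<in> Upper ` ({1..m} - X)" by (cases w) auto
    qed auto
    then show ?thesis by (simp add: card_image inj_on_def)
  qed
  have "even (card ({1..m} - X) + card ({1..n} - Y))"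
    by (rule even_card_union_of_blocks[OF pair union_of_blocks_compl[OF pair un]])
  then have Y1: "even (card ({1..n} - Y))" using X1 by simp
  have "even (card ({1..<x} - X))" if "x \<in> X" for x using gap[of "Upper x"] that by simp
  moreover have "even (card ({1..<y} - Y))" if "y \<in> Y" for y using gap[of "Lower y"] that by simp
  ultimately show ?thesis using X1 Y1 D(1,2) un by (simp add: even_gap_def)
qed

text \<open>
  In a noncrossing pairing this is the least set of blocks to which \<open>even_gap_upward_closed\<close> applies
  and whose union contains the vertex \<open>v\<close>. Without \<open>v\<close>, the least such set is \<open>through_blocks\<close>.
\<close>

definition blocks_above :: "vertex set set \<Rightarrow> vertex \<Rightarrow> vertex set set" where
  "blocks_above a v = {C \<in> a. v \<in> C \<or> spans C (key v) \<or> spans C 0}"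

definition through_blocks :: "vertex set set \<Rightarrow> vertex set set" where
  "through_blocks a = {C \<in> a. spans C 0}"

lemma even_gap_blocks_above:
  assumes pair: "pairing m n a" and nc: "noncrossing a"
    and X: "X = {x. Upper x \<in> \<Union>(blocks_above a v)}" and Y: "Y = {y. Lower y \<in> \<Union>(blocks_above a v)}"
  shows "even_gap m X \<and> even_gap n Y \<and> union_of_blocks a X Y"
proof (rule even_gap_upward_closed[OF pair _ _ _ X Y])
  fix C D u assume C: "C \<in> blocks_above a v" "u \<in> C" and D: "D \<in> a" "spans D (key u)"
  show "D \<in> blocks_above a v"
  proof (cases "C = D")
    case False
    have sp: "spans D (key u')" if "u' \<in> C" for u'
      using spans_block[OF pair nc _ D(1) False C(2) D(2) that] C(1) by (simp add: blocks_above_def)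
    then have "spans D k" if "spans C k" for k
      using spans_trans[of C D k] that by blast
    then show ?thesis using C(1) sp D(1) by (auto simp: blocks_above_def)
  qed (use C in simp)
qed (auto simp: blocks_above_def)

lemma even_gap_through_blocks:
  assumes pair: "pairing m n a" and nc: "noncrossing a"
    and X: "X = {x. Upper x \<in> \<Union>(through_blocks a)}" and Y: "Y = {y. Lower y \<in> \<Union>(through_blocks a)}"
  shows "even_gap m X \<and> even_gap n Y \<and> union_of_blocks a X Y"
proof (rule even_gap_upward_closed[OF pair _ _ _ X Y])
  fix C D u assume C: "C \<in> through_blocks a" "u \<in> C" and D: "D \<in> a" "spans D (key u)"
  show "D \<in> through_blocks a"
  proof (cases "C = D")
    case False
    have sp: "spans D (key u')" if "u' \<in> C" for u'
      using spans_block[OF pair nc _ D(1) False C(2) D(2) that] C(1) by (simp add: through_blocks_def)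
    then have "spans D 0"
      using spans_trans[of C D 0] C(1) by (auto simp: through_blocks_def)
    then show ?thesis using D(1) by (auto simp: through_blocks_def)
  qed (use C in simp)
qed (auto simp: through_blocks_def)

lemma cap_not_through: "\<not> spans {Upper i, Upper j} 0"
  by (auto simp: spans_def)

text \<open>
  If \<open>Upper i\<close> is joined to a lower vertex, then the lower row \<open>Y\<close> of a union of blocks decides whether
  it contains \<open>Upper i\<close>. If \<open>Upper i\<close> is joined within the upper row, then the blocks above it and the
  through blocks have the same lower row, but only the former contain \<open>Upper i\<close>.
\<close>

lemma capped_iff:
  assumes pair: "pairing m n a" and nc: "noncrossing a" and i: "i \<in> {1..m}"
  shows "(\<exists>j. {Upper i, Upper j} \<in> a) \<longleftrightarrow>
    (\<exists>X X' Y. even_gap m X \<and> even_gap m X' \<and> even_gap n Y \<and>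
      union_of_blocks a X Y \<and> union_of_blocks a X' Y \<and> i \<in> X \<and> i \<notin> X')" (is "?L \<longleftrightarrow> ?R")
proof
  assume ?L
  then obtain j where j: "{Upper i, Upper j} \<in> a" by blast
  let ?S = "blocks_above a (Upper i)" and ?T = "through_blocks a"
  have "Lower y \<in> \<Union>?S \<longleftrightarrow> Lower y \<in> \<Union>?T" for y
  proof
    assume "Lower y \<in> \<Union>?S"
    then obtain C where C: "C \<in> ?S" "Lower y \<in> C" by blast
    have Ca: "C \<in> a" using C(1) by (simp add: blocks_above_def)
    have y: "y \<ge> 1" using pairing_in_vertices[OF pair Ca C(2)] by simp
    have "Upper i \<notin> C" using pairing_block_unique[OF pair Ca j, of "Upper i"] C(2) by auto
    then have "spans C 0"
      using C y unfolding blocks_above_def spans_def by force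
    then show "Lower y \<in> \<Union>?T" using C Ca by (auto simp: through_blocks_def)
  qed (auto simp: blocks_above_def through_blocks_def)
  then have Y: "{y. Lower y \<in> \<Union>?S} = {y. Lower y \<in> \<Union>?T}" by blast
  have "Upper i \<in> \<Union>?S" using j by (auto simp: blocks_above_def)
  moreover have "Upper i \<notin> \<Union>?T"
  proof
    assume "Upper i \<in> \<Union>?T"
    then obtain C where C: "C \<in> a" "spans C 0" "Upper i \<in> C" by (auto simp: through_blocks_def)
    then have "C = {Upper i, Upper j}" using pairing_block_unique[OF pair C(1) j] by simp
    then show False using C(2) cap_not_through by simp
  qed
  ultimately show ?R
    using even_gap_blocks_above[OF pair nc refl refl, of "Upper i"]
      even_gap_through_blocks[OF pair nc refl refl] Y by (metis mem_Collect_eq)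
next
  assume ?R
  then obtain X X' Y where u: "union_of_blocks a X Y" "union_of_blocks a X' Y" "i \<in> X" "i \<notin> X'" by blast
  have "Upper i \<in> vertices m n" using i by simp
  then obtain w where w: "{Upper i, w} \<in> a" using pairing_partner[OF pair] by blast
  have w': "{w, Upper i} \<in> a" using w by (simp add: insert_commute)
  show ?L
  proof (cases w)
    case (Lower k)
    have "k \<in> Y" using union_of_blocksD(3)[OF pair u(1) w] u(3) Lower by simp
    then have "i \<in> X'" using union_of_blocksD(3)[OF pair u(2) w'] Lower by simp
    then show ?thesis using u(4) by simp
  qed (use w in auto)
qed

text \<open>
  If \<open>i\<close> and \<open>j\<close> lie in different blocks within the upper row and no even-gap union separates them,
  then each of the two blocks must enclose the other, which is impossible.
\<close>

lemma cap_iff: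
  assumes pair: "pairing m n a" and nc: "noncrossing a"
    and ij: "i \<in> {1..m}" "j \<in> {1..m}" "i \<noteq> j"
  shows "{Upper i, Upper j} \<in> a \<longleftrightarrow>
    (\<exists>k. {Upper i, Upper k} \<in> a) \<and> (\<exists>k. {Upper j, Upper k} \<in> a) \<and>
    (\<forall>X Y. even_gap m X \<longrightarrow> even_gap n Y \<longrightarrow> union_of_blocks a X Y \<longrightarrow> (i \<in> X \<longleftrightarrow> j \<in> X))"
proof
  assume a: "{Upper i, Upper j} \<in> a"
  then have a': "{Upper j, Upper i} \<in> a" by (simp add: insert_commute)
  have "i \<in> X \<longleftrightarrow> j \<in> X" if "union_of_blocks a X Y" for X Y
    using union_of_blocksD(3)[OF pair that a] union_of_blocksD(3)[OF pair that a'] by auto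
  then show "(\<exists>k. {Upper i, Upper k} \<in> a) \<and> (\<exists>k. {Upper j, Upper k} \<in> a) \<and>
    (\<forall>X Y. even_gap m X \<longrightarrow> even_gap n Y \<longrightarrow> union_of_blocks a X Y \<longrightarrow> (i \<in> X \<longleftrightarrow> j \<in> X))"
    using a a' by blast
next
  assume "(\<exists>k. {Upper i, Upper k} \<in> a) \<and> (\<exists>k. {Upper j, Upper k} \<in> a) \<and>
    (\<forall>X Y. even_gap m X \<longrightarrow> even_gap n Y \<longrightarrow> union_of_blocks a X Y \<longrightarrow> (i \<in> X \<longleftrightarrow> j \<in> X))"
  then obtain k l where kl: "{Upper i, Upper k} \<in> a" "{Upper j, Upper l} \<in> a"
    and same: "\<And>X Y. even_gap m X \<Longrightarrow> even_gap n Y \<Longrightarrow> union_of_blocks a X Y \<Longrightarrow> i \<in> X \<longleftrightarrow> j \<in> X"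
    by blast
  have same': "Upper i \<in> \<Union>(blocks_above a v) \<longleftrightarrow> Upper j \<in> \<Union>(blocks_above a v)" for v
    using same even_gap_blocks_above[OF pair nc refl refl, of v] by blast
  show "{Upper i, Upper j} \<in> a"
  proof (rule ccontr)
    assume no: "{Upper i, Upper j} \<notin> a"
    let ?B = "{Upper i, Upper k}" and ?C = "{Upper j, Upper l}"
    have ne: "?B \<noteq> ?C" using no kl ij by (metis doubleton_eq_iff vertex.inject(1))
    have "Upper j \<in> \<Union>(blocks_above a (Upper i))" using same'[of "Upper i"] kl(1) by (auto simp: blocks_above_def)
    then obtain C where C: "C \<in> blocks_above a (Upper i)" "Upper j \<in> C" by blast
    then have "C = ?C" using pairing_block_unique[OF pair _ kl(2)] by (auto simp: blocks_above_def)
    moreover have "Upper i \<notin> ?C" using pairing_block_unique[OF pair kl] ne by blast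
    ultimately have 1: "spans ?C (key (Upper i))"
      using C(1) cap_not_through by (auto simp: blocks_above_def)
    have "Upper i \<in> \<Union>(blocks_above a (Upper j))" using same'[of "Upper j"] kl(2) by (auto simp: blocks_above_def)
    then obtain B where B: "B \<in> blocks_above a (Upper j)" "Upper i \<in> B" by blast
    then have "B = ?B" using pairing_block_unique[OF pair _ kl(1)] by (auto simp: blocks_above_def)
    moreover have "Upper j \<notin> ?B" using pairing_block_unique[OF pair kl] ne by blast
    ultimately have 2: "spans ?B (key (Upper j))"
      using B(1) cap_not_through by (auto simp: blocks_above_def)
    have b: "spans ?C (key u)" if "u \<in> ?B" for u
      using spans_block[OF pair nc kl ne _ 1 that] by simp
    have c: "spans ?B (key u)" if "u \<in> ?C" for u
      using spans_block[OF pair nc kl(2,1) ne[symmetric] _ 2 that] by simp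
    show False
      using b[of "Upper i"] b[of "Upper k"] c[of "Upper j"] c[of "Upper l"] by (auto simp: spans_def)
  qed
qed

lemma caps_eq:
  assumes a: "pairing m n a" "noncrossing a" and b: "pairing m n b" "noncrossing b"
    and eq: "\<And>X Y. even_gap m X \<Longrightarrow> even_gap n Y \<Longrightarrow> union_of_blocks a X Y \<longleftrightarrow> union_of_blocks b X Y"
  shows "{Upper i, Upper j} \<in> a \<longleftrightarrow> {Upper i, Upper j} \<in> b"
proof (cases "i \<in> {1..m} \<and> j \<in> {1..m} \<and> i \<noteq> j")
  case True
  then have ij: "i \<in> {1..m}" "j \<in> {1..m}" "i \<noteq> j" by auto
  have capped: "(\<exists>k. {Upper i, Upper k} \<in> a) \<longleftrightarrow> (\<exists>k. {Upper i, Upper k} \<in> b)" if "i \<in> {1..m}" for i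
    unfolding capped_iff[OF a that] capped_iff[OF b that] using eq by metis
  show ?thesis
    unfolding cap_iff[OF a ij] cap_iff[OF b ij] capped[OF ij(1)] capped[OF ij(2)] using eq by metis
next
  case False
  have "i \<in> {1..m} \<and> j \<in> {1..m} \<and> i \<noteq> j" if "pairing m n c" "{Upper i, Upper j} \<in> c" for c
    using pairing_in_vertices[OF that, of "Upper i"] pairing_in_vertices[OF that, of "Upper j"]
      pairing_neq[OF that] by auto
  then show ?thesis using False a b by blast
qed

text \<open>
  If the partners of \<open>Upper i\<close> in \<open>a\<close> and \<open>b\<close> differ, the one further to the left is joined in the
  other pairing to an upper vertex, which is left of \<open>i\<close> by noncrossing. There the pairings
  agree by the induction hypothesis, so that vertex and \<open>i\<close> would have the same partner.
\<close>

lemma through_partner_step: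
  assumes a: "pairing m n a" "noncrossing a" and b: "pairing m n b" "noncrossing b"
    and upper: "\<And>i j. {Upper i, Upper j} \<in> a \<longleftrightarrow> {Upper i, Upper j} \<in> b"
    and lower: "\<And>i j. {Lower i, Lower j} \<in> a \<longleftrightarrow> {Lower i, Lower j} \<in> b"
    and IH: "\<And>i' j. i' < i \<Longrightarrow> {Upper i', Lower j} \<in> a \<longleftrightarrow> {Upper i', Lower j} \<in> b"
    and ij: "{Upper i, Lower j} \<in> a"
  shows "{Upper i, Lower j} \<in> b"
proof -
  have ij': "{Lower j, Upper i} \<in> a" using ij by (simp add: insert_commute)
  have V: "Upper i \<in> vertices m n" "Lower j \<in> vertices m n"
    using pairing_in_vertices[OF a(1) ij, of "Upper i"] pairing_in_vertices[OF a(1) ij, of "Lower j"]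
    by simp_all
  then obtain v w where v: "{Upper i, v} \<in> b" and w: "{Lower j, w} \<in> b"
    using pairing_partner[OF b(1)] by metis
  obtain k where k: "{Upper i, Lower k} \<in> b"
  proof (cases v)
    case (Upper l)
    then have "Upper l = Lower j"
      using v upper pairing_partner_unique[OF a(1) _ ij] by blast
    then show thesis by simp
  qed (use v that in simp)
  obtain i2 where i2: "{Upper i2, Lower j} \<in> b"
  proof (cases w)
    case (Lower l)
    then have "Lower l = Upper i"
      using w lower pairing_partner_unique[OF a(1) _ ij'] by blast
    then show thesis by simp
  qed (use w that in \<open>simp add: insert_commute\<close>)
  show ?thesis
  proof (rule ccontr)
    assume no: "{Upper i, Lower j} \<notin> b"
    then have jk: "j \<noteq> k" using k by auto
    consider "j < k" | "k < j" using jk by linarith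
    then show False
    proof cases
      case 1
      have "\<not> i < i2"
        using noncrossingD[OF b(2) i2 k] 1 V(1) by auto
      moreover have "i \<noteq> i2" using no i2 by auto
      ultimately have "{Upper i2, Lower j} \<in> a" using IH i2 by simp
      then have "{Lower j, Upper i2} \<in> a" by (simp add: insert_commute)
      then show False using pairing_partner_unique[OF a(1) ij'] \<open>i \<noteq> i2\<close> by auto
    next
      case 2
      have "Lower k \<in> vertices m n" by (rule pairing_in_vertices[OF b(1) k]) simp
      then obtain u where u: "{Lower k, u} \<in> a" using pairing_partner[OF a(1)] by metis
      have k': "{Lower k, Upper i} \<in> b" using k by (simp add: insert_commute)
      obtain i3 where i3: "{Upper i3, Lower k} \<in> a"
      proof (cases u)
        case (Lower l)
        then have "Lower l = Upper i"
          using u lower pairing_partner_unique[OF b(1) _ k'] by blast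
        then show thesis by simp
      qed (use u that in \<open>simp add: insert_commute\<close>)
      have "\<not> i < i3"
        using noncrossingD[OF a(2) i3 ij] 2 V(1) by auto
      moreover have "i \<noteq> i3"
        using i3 ij jk pairing_partner_unique[OF a(1) ij] by auto
      ultimately have "{Upper i3, Lower k} \<in> b" using IH i3 by simp
      then have "{Lower k, Upper i3} \<in> b" by (simp add: insert_commute)
      then show False using pairing_partner_unique[OF b(1) k'] \<open>i \<noteq> i3\<close> by auto
    qed
  qed
qed

lemma eq_if_even_gap_unions_eq:
  assumes a: "pairing m n a" "noncrossing a" and b: "pairing m n b" "noncrossing b"
    and eq: "\<And>X Y. even_gap m X \<Longrightarrow> even_gap n Y \<Longrightarrow> union_of_blocks a X Y \<longleftrightarrow> union_of_blocks b X Y"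
  shows "a = b"
proof -
  note upper = caps_eq[OF a b eq]
  have lower: "{Lower i, Lower j} \<in> a \<longleftrightarrow> {Lower i, Lower j} \<in> b" for i j
    using caps_eq[OF pairing_TL_star[OF a(1)] noncrossing_TL_star[OF a(2)]
        pairing_TL_star[OF b(1)] noncrossing_TL_star[OF b(2)], of i j]
      eq union_of_blocks_star[OF a(1)] union_of_blocks_star[OF b(1)]
    by (simp add: TL_star_iff)
  have through: "{Upper i, Lower j} \<in> a \<longleftrightarrow> {Upper i, Lower j} \<in> b" for i j
  proof (induction i arbitrary: j rule: less_induct)
    case (less i)
    show ?case
      using through_partner_step[OF a b upper lower less.IH]
        through_partner_step[OF b a upper[symmetric] lower[symmetric] less.IH[symmetric]] by blast
  qed
  have pairs: "{v, w} \<in> a \<longleftrightarrow> {v, w} \<in> b" for v w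
    using upper lower through by (cases v; cases w) (simp_all add: insert_commute)
  have "\<exists>v w. B = {v, w}" if "B \<in> a \<union> b" for B
  proof -
    have "card B = 2" using that a(1) b(1) by (auto simp: pairing_def)
    then show ?thesis by (auto simp: card_2_iff)
  qed
  then show ?thesis using pairs by blast
qed

section \<open>Matrix categories and endomorphism monoids\<close>

lemma category_mat_cat: "category (mat_cat :: (nat, 'k::semiring_1 mat) icat)"
  by unfold_locales (auto simp: mat_cat_def)

lemma category_indexed_mat_cat:
  "category (indexed_mat_cat :: ('i list, 'i list \<times> 'i list \<times> 'k::semiring_1 mat) icat)"
  by unfold_locales (auto simp: indexed_mat_cat_def)

lemma monoid_End:
  assumes "category C" "x \<in> Obj C"
  shows "Group.monoid (End C x)"
proof -
  interpret category C by fact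
  show ?thesis
    using assms(2)
    by (unfold_locales)
      (auto simp: End_def comp_in_hom comp_assoc ident_in_hom ident_left ident_right)
qed

lemma faithful_involutive_monoid_rep_End:
  assumes "involutive_cat_rep C D F0 F" "x \<in> Obj C" "inj_on (F x x) (Hom C x x)"
  shows "faithful_involutive_monoid_rep (End C x) (Star C) (End D (F0 x)) (Star D) (F x x)"
proof -
  interpret involutive_cat_rep C D F0 F by fact
  show ?thesis
    unfolding faithful_involutive_monoid_rep_def
    using assms(2,3) monoid_End[OF C.category_axioms] monoid_End[OF D.category_axioms]
    by (auto simp: End_def hom_def rep_obj rep_hom rep_comp rep_ident rep_star)
qed

section \<open>Sizes, small hom-sets and sums of ones\<close>

lemma sum_indicator_idempotent:
  assumes "(1 :: 'k::semiring_1) + 1 = 1" "finite K"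
  shows "(\<Sum>k\<in>K. if P k then 1 else 0 :: 'k) = (if \<exists>k\<in>K. P k then 1 else 0)"
proof -
  have two: "(2 :: 'k) = 1" using assms(1) by simp
  show ?thesis using assms(2) by (induction rule: finite_induct) (auto simp: two)
qed

lemma fibo_less:
  assumes "1 \<le> m" "m < n" shows "fibo m < fibo n"
proof -
  have "fibo (Suc (m - 1)) < fibo (Suc (n - 1))"
    by (rule lift_Suc_mono_less[of "\<lambda>n. fibo (Suc n)"])
      (use assms in \<open>auto simp: fibo_def fib_neq_0_nat\<close>)
  then show ?thesis using assms by simp
qed

lemma fibo_eq_less:
  assumes "fibo m = fibo n" "m < n" shows "m = 0 \<and> n = 1"
proof (cases m)
  case 0
  have "fibo 0 = fibo 1" by (simp add: fibo_def)
  then have "fibo 1 = fibo n" using assms(1) 0 by metis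
  then show ?thesis using fibo_less[of 1 n] assms(2) 0 by linarith
next
  case (Suc k)
  then show ?thesis using fibo_less[of m n] assms by simp
qed

lemma fibo_eq:
  assumes "fibo m = fibo n" shows "m = n \<or> {m, n} = {0, 1}"
  using fibo_eq_less[of m n] fibo_eq_less[of n m] assms
  by (cases m n rule: linorder_cases) auto

lemma TL_hom_parity:
  assumes "a \<in> TL_hom m n" shows "even (m + n)"
proof -
  have "pairing m n a" using assms by (simp add: TL_hom_iff)
  then have "even (card (vertices m n))"
    using pairing_in_vertices by (intro even_card_closed) blast+
  then show ?thesis by (simp add: vertices_rows card_rows)
qed

lemma pairing_two_vertices:
  assumes pair: "pairing m n a" and two: "card (vertices m n) = 2"
  shows "a = {vertices m n}"
proof -
  have "B = vertices m n" if "B \<in> a" for B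
    using that pair pairing_in_vertices[OF pair that] two finite_vertices
    by (intro card_subset_eq) (auto simp: pairing_def)
  moreover have "a \<noteq> {}"
  proof
    assume "a = {}"
    then have "vertices m n = {}" using pairing_partition[OF pair] by (simp add: partition_on_def)
    then show False using two by simp
  qed
  ultimately show ?thesis by blast
qed

lemma TL_hom_small:
  shows "a \<in> TL_hom 0 0 \<Longrightarrow> a = TL_ident 0" and "a \<in> TL_hom 1 1 \<Longrightarrow> a = TL_ident 1"
proof -
  assume "a \<in> TL_hom 0 0"
  then have "partition_on {} a" by (simp add: TL_hom_def vertices_def)
  then show "a = TL_ident 0" by (simp add: TL_ident_def partition_on_empty)
next
  assume "a \<in> TL_hom 1 1"
  then have a: "pairing 1 1 a" by (simp add: TL_hom_iff)
  have two: "card (vertices 1 1) = 2" by (simp add: vertices_rows card_rows)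
  show "a = TL_ident 1"
    unfolding pairing_two_vertices[OF a two] pairing_two_vertices[OF pairing_TL_ident two] ..
qed

section \<open>The matrix representation\<close>

locale even_gap_enumeration =
  fixes es :: "nat \<Rightarrow> nat set list"
  assumes ordering: "distinct (es n) \<and> set (es n) = even_gap_subsets n"
begin

lemma length_es: "length (es n) = fibo n"
  using ordering[of n] card_even_gap_subsets[of n] distinct_card by metis

lemma even_gap_nth: "i < fibo n \<Longrightarrow> even_gap n (es n ! i)"
  using ordering[of n] length_es[of n] nth_mem[of i "es n"] by (auto simp: even_gap_subsets_eq)

lemma even_gap_index:
  assumes "even_gap n X" obtains i where "i < fibo n" "es n ! i = X"
proof -
  have "X \<in> set (es n)" using ordering[of n] assms by (simp add: even_gap_subsets_eq)
  then show thesis using that by (auto simp: in_set_conv_nth length_es)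
qed

lemma es_inj: "es m = es n \<Longrightarrow> m = n"
proof -
  assume "es m = es n"
  then have "even_gap_subsets m = even_gap_subsets n" using ordering by metis
  then have eq: "{X. even_gap m X} = {X. even_gap n X}" by (simp add: even_gap_subsets_eq)
  have full: "even_gap k {1..k}" for k
  proof -
    have "even (card ({1..<x} - {1..k}))" if "x \<in> {1..k}" for x
    proof -
      have "{1..<x} - {1..k} = {}" using that by auto
      then show ?thesis by (simp only: card.empty even_zero)
    qed
    then show ?thesis unfolding even_gap_def by simp
  qed
  have "even_gap n {1..m}" "even_gap m {1..n}" using full[of m] full[of n] eq by blast+
  then have "{1..m} \<subseteq> {1..n}" "{1..n} \<subseteq> {1..m}" by (simp_all only: even_gap_def)
  then have "card {1..m} = card {1..n}" by (metis subset_antisym)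
  then show ?thesis by simp
qed

lemma TL_mat_carrier: "(TL_mat es m n a :: 'k::semiring_1 mat) \<in> carrier_mat (fibo m) (fibo n)"
  by (simp add: TL_mat_def)

lemma TL_mat_ident: "(TL_mat es n n (TL_ident n) :: 'k::semiring_1 mat) = 1\<^sub>m (fibo n)"
proof (rule eq_matI)
  fix i j assume ij: "i < dim_row (1\<^sub>m (fibo n) :: 'k mat)" "j < dim_col (1\<^sub>m (fibo n) :: 'k mat)"
  have "es n ! i = es n ! j \<longleftrightarrow> i = j"
    using ordering[of n] ij by (simp add: nth_eq_iff_index_eq length_es)
  moreover have "es n ! i \<subseteq> {1..n}" using even_gap_nth[of i n] ij by (simp add: even_gap_def)
  ultimately show "TL_mat es n n (TL_ident n) $$ (i, j) = (1\<^sub>m (fibo n) :: 'k mat) $$ (i, j)"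
    using ij by (simp add: TL_mat_def union_of_blocks_ident)
qed (simp_all add: TL_mat_def)

lemma TL_mat_comp:
  assumes idem: "(1 :: 'k::semiring_1) + 1 = 1" and a: "a \<in> TL_hom m n" and b: "b \<in> TL_hom n t"
  shows "(TL_mat es m t (TL_comp m n t a b) :: 'k mat) = TL_mat es m n a * TL_mat es n t b"
proof (rule eq_matI)
  fix i j
  assume "i < dim_row (TL_mat es m n a * TL_mat es n t b :: 'k mat)"
    and "j < dim_col (TL_mat es m n a * TL_mat es n t b :: 'k mat)"
  then have ij: "i < fibo m" "j < fibo t" by (simp_all add: TL_mat_def)
  let ?P = "\<lambda>k. union_of_blocks a (es m ! i) (es n ! k) \<and> union_of_blocks b (es n ! k) (es t ! j)"
  have "(TL_mat es m n a * TL_mat es n t b :: 'k mat) $$ (i, j) = (\<Sum>k\<in>{0..<fibo n}. if ?P k then 1 else 0)"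
    using ij by (auto simp: TL_mat_def scalar_prod_def intro!: sum.cong)
  also have "\<dots> = (if \<exists>k\<in>{0..<fibo n}. ?P k then 1 else 0)"
    by (rule sum_indicator_idempotent[OF idem]) simp
  also have "(\<exists>k\<in>{0..<fibo n}. ?P k) \<longleftrightarrow>
      (\<exists>Z. even_gap n Z \<and> union_of_blocks a (es m ! i) Z \<and> union_of_blocks b Z (es t ! j))"
    using even_gap_nth[of _ n] even_gap_index[of n] by (metis atLeast0LessThan lessThan_iff)
  also have "\<dots> \<longleftrightarrow> union_of_blocks (TL_comp m n t a b) (es m ! i) (es t ! j)"
    using a b ij even_gap_nth
    by (intro union_of_blocks_comp_even_gap[symmetric]) (auto simp: TL_hom_iff)
  finally show "TL_mat es m t (TL_comp m n t a b) $$ (i, j) = (TL_mat es m n a * TL_mat es n t b :: 'k mat) $$ (i, j)"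
    using ij by (simp add: TL_mat_def)
qed (simp_all add: TL_mat_def)

lemma TL_mat_star:
  assumes a: "a \<in> TL_hom m n"
  shows "(TL_mat es n m (TL_star a) :: 'k::semiring_1 mat) = transpose_mat (TL_mat es m n a)"
proof -
  have "pairing m n a" using a by (simp add: TL_hom_iff)
  then show ?thesis
    by (intro eq_matI) (auto simp: TL_mat_def union_of_blocks_star)
qed

lemma TL_mat_inj:
  assumes a: "a \<in> TL_hom m n" and b: "b \<in> TL_hom m n"
    and eq: "(TL_mat es m n a :: 'k::semiring_1 mat) = TL_mat es m n b"
  shows "a = b"
proof (rule eq_if_even_gap_unions_eq)
  show "pairing m n a" "noncrossing a" "pairing m n b" "noncrossing b"
    using a b by (simp_all add: TL_hom_iff)
  fix X Y assume "even_gap m X" "even_gap n Y"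
  then obtain i j where ij: "i < fibo m" "es m ! i = X" "j < fibo n" "es n ! j = Y"
    using even_gap_index by metis
  have "(TL_mat es m n a :: 'k mat) $$ (i, j) = TL_mat es m n b $$ (i, j)" using eq by simp
  then show "union_of_blocks a X Y \<longleftrightarrow> union_of_blocks b X Y"
    using ij by (simp add: TL_mat_def split: if_splits)
qed

lemma involutive_cat_rep_TL_mat:
  assumes "(1 :: 'k::semiring_1) + 1 = 1"
  shows "involutive_cat_rep TL (mat_cat :: (nat, 'k mat) icat) fibo (TL_mat es)"
  by (intro involutive_cat_rep.intro cat_rep.intro cat_rep_axioms.intro
      involutive_cat_rep_axioms.intro category_TL category_mat_cat)
    (auto simp: TL_def mat_cat_def TL_mat_carrier TL_mat_ident TL_mat_comp[OF assms] TL_mat_star)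

lemma faithful_TL_indexed_mat:
  assumes "(1 :: 'k::semiring_1) + 1 = 1"
  shows "faithful_involutive_cat_rep TL
       (indexed_mat_cat :: (nat set list, nat set list \<times> nat set list \<times> 'k mat) icat)
       es (TL_indexed_mat es)"
proof (intro faithful_involutive_cat_rep.intro faithful_involutive_cat_rep_axioms.intro
    involutive_cat_rep.intro cat_rep.intro cat_rep_axioms.intro
    involutive_cat_rep_axioms.intro category_TL category_indexed_mat_cat)
  let ?C = "indexed_mat_cat :: (nat set list, nat set list \<times> nat set list \<times> 'k mat) icat"
  show "inj_on es (Obj TL)" by (rule inj_onI) (rule es_inj)
  show "inj_on (\<lambda>(x, y, a). TL_indexed_mat es x y a :: nat set list \<times> nat set list \<times> 'k mat)
      {(x, y, a). x \<in> Obj TL \<and> y \<in> Obj TL \<and> a \<in> Hom TL x y}"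
    by (rule inj_onI) (clarsimp simp: TL_indexed_mat_def TL_def dest!: es_inj, rule TL_mat_inj)
qed (use ordering in \<open>auto simp: TL_def indexed_mat_cat_def TL_indexed_mat_def length_es TL_mat_carrier
      TL_mat_ident TL_mat_comp[OF assms] TL_mat_star\<close>)

text \<open>
  The sizes determine the objects up to exchanging 0 and 1, and \<open>m\<close> and \<open>n\<close> have the same parity; so
  if the objects differ, both matrices come from identities of 0 and 1.
\<close>

lemma TL_mat_eq_cases:
  assumes a: "a \<in> TL_hom m n" and b: "b \<in> TL_hom p q"
    and eq: "(TL_mat es m n a :: 'k::semiring_1 mat) = TL_mat es p q b"
  shows "(m, n, a) = (p, q, b) \<or> {(m, n, a), (p, q, b)} = {(0, 0, TL_ident 0), (1, 1, TL_ident 1)}"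
proof -
  have "fibo m = fibo p" "fibo n = fibo q"
    using arg_cong[OF eq, of dim_row] arg_cong[OF eq, of dim_col] by (simp_all add: TL_mat_def)
  then have mp: "m = p \<or> m = 0 \<and> p = 1 \<or> m = 1 \<and> p = 0" and nq: "n = q \<or> n = 0 \<and> q = 1 \<or> n = 1 \<and> q = 0"
    using fibo_eq by (metis doubleton_eq_iff)+
  have par: "even (m + n)" "even (p + q)" using TL_hom_parity a b by blast+
  consider "m = p" "n = q" | "m = 0" "n = 0" "p = 1" "q = 1" | "m = 1" "n = 1" "p = 0" "q = 0"
    using mp nq par by fastforce
  then show ?thesis
  proof cases
    case 1
    then have "a = b" using TL_mat_inj[OF a] b eq by simp
    then show ?thesis using 1 by simp
  next
    case 2
    then show ?thesis using TL_hom_small a b by auto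
  next
    case 3
    then show ?thesis using TL_hom_small a b by auto
  qed
qed

end

theorem theorem6p14:
  fixes es :: "nat \<Rightarrow> nat set list"
  assumes idempotent: "(1 :: 'k::semiring_1) + 1 = 1"
    and ordering: "\<And>n. distinct (es n) \<and> set (es n) = even_gap_subsets n"
  shows
    "involutive_cat_rep TL (mat_cat :: (nat, 'k mat) icat) fibo (TL_mat es) \<and>
     faithful_involutive_cat_rep TL
       (indexed_mat_cat :: (nat set list, nat set list \<times> nat set list \<times> 'k mat) icat)
       es (TL_indexed_mat es) \<and>
     (\<forall>m n. fibo m = fibo n \<longrightarrow> m = n \<or> {m, n} = {0, 1}) \<and>
     (\<forall>m n p q. \<forall>a\<in>Hom TL m n. \<forall>b\<in>Hom TL p q.
        (TL_mat es m n a :: 'k mat) = TL_mat es p q b \<longrightarrow>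
          (m, n, a) = (p, q, b) \<or>
          {(m, n, a), (p, q, b)} = {(0, 0, Ident TL 0), (1, 1, Ident TL 1)}) \<and>
     (\<forall>n. faithful_involutive_monoid_rep
        (End TL n) (Star TL)
        (End (mat_cat :: (nat, 'k mat) icat) (fibo n)) (Star (mat_cat :: (nat, 'k mat) icat))
        (TL_mat es n n))"
proof -
  interpret even_gap_enumeration es by unfold_locales (rule ordering)
  note rep = involutive_cat_rep_TL_mat[OF idempotent]
  have hom: "Hom TL = TL_hom" "Ident TL = TL_ident" "Obj TL = UNIV" by (simp_all add: TL_def)
  have "inj_on (TL_mat es n n :: _ \<Rightarrow> 'k mat) (Hom TL n n)" for n
    unfolding hom by (rule inj_onI) (rule TL_mat_inj)
  then have mon: "faithful_involutive_monoid_rep (End TL n) (Star TL)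
      (End (mat_cat :: (nat, 'k mat) icat) (fibo n)) (Star (mat_cat :: (nat, 'k mat) icat))
      (TL_mat es n n)" for n
    using faithful_involutive_monoid_rep_End[OF rep] by (simp add: hom)
  show ?thesis
    unfolding hom
  proof (intro conjI allI ballI impI)
    show "m = n \<or> {m, n} = {0, 1}" if "fibo m = fibo n" for m n
      by (rule fibo_eq[OF that])
    show "(m, n, a) = (p, q, b) \<or> {(m, n, a), (p, q, b)} = {(0, 0, TL_ident 0), (1, 1, TL_ident 1)}"
      if "a \<in> TL_hom m n" "b \<in> TL_hom p q" "(TL_mat es m n a :: 'k mat) = TL_mat es p q b" for m n p q a b
      by (rule TL_mat_eq_cases[OF that])
  qed (use rep faithful_TL_indexed_mat[OF idempotent] mon in simp_all)
qed

end
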